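(* Let $\mathcal{H}$ be a Hart-van Mill collection of subsets of $\mathbb{R}$. For distinct, nonempty subsets $\mathcal{J},\mathcal{J}_1$ of $\mathcal{H}$ let $X=X(\mathcal{J})$ and $X_1=X(\mathcal{J}_1)$ be the associated IHLOTS. If $\alpha$ and $\beta$ are countable limit ordinals, then $\widehat{X_\alpha}$ is not order isomorphic to $\widehat{(X_1)_\beta}$. In particular, if for some $Y\in\mathcal{J}$ we have $-Y\notin\mathcal{J}$, then $\widehat{X_\alpha}$ is not symmetric.
   Context: A LOTS is a totally ordered set with the order topology. The completion $\hat Z$ of an order dense LOTS $Z$ is the (essentially unique) order dense LOTS containing $Z$ as a dense subset in which every nonempty bounded subset has a supremum and infimum, and having a max (resp. min) iff $Z$ does. A LOTS is symmetric if it admits an order reversing bijection onto itself. A HLOTS is a LOTS with at least three points which is order isomorphic to every nonempty open convex subset of itself; an IHLOTS is a HLOTS which is not complete (some nonempty bounded subset lacks a supremum or an infimum). An order map is a map with $s\le t\Rightarrow f(s)\le f(t)$. A Bi-Bernstein (BB) set is a subset $Y\subset\mathbb{R}$ such that both $Y$ and $\mathbb{R}\setminus Y$ meet every Cantor set in $\mathbb{R}$. Let $\mathcal{G}$ be the group of maps $t\mapsto at+b$ of $\mathbb{R}$ with $a,b\in\mathbb{Q}$, $a>0$. Let $\mathbf{c}=2^{\aleph_0}$. A nonempty set $\mathcal{H}$ of subsets of $\mathbb{R}$ is a Hart-van Mill collection with base set $V\subset\mathbb{R}$ if: (i) $\mathbb{Q}\subset V$; (ii) each $Y\in\mathcal{H}\cup\{V\}$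 is a BB set that is $\mathcal{G}$ invariant; (iii) the elements of $\mathcal{H}\cup\{V\}$ are pairwise disjoint; (iv) if $Y\in\mathcal{H}$, then $-Y=\{-x:x\in Y\}$ is an element of $\mathcal{H}$ distinct from $Y$; (v) if $f:\mathbb{R}\to\mathbb{R}$ is an order map and $Y\in\mathcal{H}$ is such that $f(Y)\setminus Y$ has cardinality $\mathbf{c}$, then $f(Y)\cap V$ has cardinality $\mathbf{c}$. For nonempty $\mathcal{J}\subset\mathcal{H}$, $X(\mathcal{J})=\mathbb{R}\setminus\bigcup\mathcal{J}$ with the order induced from $\mathbb{R}$; it contains $\mathbb{Q}$ and is an IHLOTS. For such $X$ and a positive ordinal $\alpha$, $X_\alpha=\{x:\alpha\to X\mid -1\le x(i)\le 1\text{ for }0<i<\alpha\}$ with the lexicographic order; it is order dense. *)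

theory Defs
  imports "HOL-Analysis.Analysis" "HOL-Library.Equipollence" "HOL-Library.FuncSet"
begin

text \<open>
  A totally ordered set is a reflexive relation \<open>r\<close> with \<open>Linear_order r\<close>; its points are
  \<open>Field r\<close>.  Order isomorphism is the library's \<open>iso\<close> (see \<open>iso_iff2\<close>).
\<close>

section \<open>Ordered spaces and completions\<close>

definition order_isomorphic :: "'a rel \<Rightarrow> 'b rel \<Rightarrow> bool" where
  "order_isomorphic r s \<longleftrightarrow> (\<exists>f. iso r s f)"

definition symmetric_order :: "'a rel \<Rightarrow> bool" where
  "symmetric_order r \<longleftrightarrow> (\<exists>f. iso r (r\<inverse>) f)"

definition order_dense :: "'a rel \<Rightarrow> bool" where
  "order_dense r \<longleftrightarrow>
     (\<forall>x y. (x, y) \<in> r - Id \<longrightarrow> (\<exists>z. (x, z) \<in> r - Id \<and> (z, y) \<in> r - Id))"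

text \<open>
  The open rays form a subbase.  The whole space is added explicitly, since a one-point order
  has no nonempty open ray.
\<close>

definition lots_topology :: "'a rel \<Rightarrow> 'a topology" where
  "lots_topology r =
     topology_generated_by (insert (Field r) (underS r ` Field r \<union> aboveS r ` Field r))"

definition is_supremum :: "'a rel \<Rightarrow> 'a set \<Rightarrow> 'a \<Rightarrow> bool" where
  "is_supremum r S u \<longleftrightarrow> u \<in> Above r S \<and> (\<forall>v \<in> Above r S. (u, v) \<in> r)"

definition is_infimum :: "'a rel \<Rightarrow> 'a set \<Rightarrow> 'a \<Rightarrow> bool" where
  "is_infimum r S u \<longleftrightarrow> u \<in> Under r S \<and> (\<forall>v \<in> Under r S. (v, u) \<in> r)"

definition complete_order :: "'a rel \<Rightarrow> bool" where
  "complete_order r \<longleftrightarrow>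
     (\<forall>S \<subseteq> Field r. S \<noteq> {} \<and> Above r S \<noteq> {} \<and> Under r S \<noteq> {} \<longrightarrow>
        (\<exists>u. is_supremum r S u) \<and> (\<exists>u. is_infimum r S u))"

definition has_max :: "'a rel \<Rightarrow> bool" where
  "has_max r \<longleftrightarrow> Above r (Field r) \<noteq> {}"

definition has_min :: "'a rel \<Rightarrow> bool" where
  "has_min r \<longleftrightarrow> Under r (Field r) \<noteq> {}"

text \<open>
  \<open>C\<close> is a completion of \<open>Z\<close>.  The completion is only determined up to isomorphism over \<open>Z\<close>,
  so it is given by its defining properties; \<open>e\<close> identifies \<open>Z\<close> with a suborder of \<open>C\<close>.
  Existence is shown below in \<open>completion_exists\<close> and \<open>hvm_completion_exists\<close>.
\<close>

definition is_completion :: "'a rel \<Rightarrow> 'c rel \<Rightarrow> bool" where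
  "is_completion Z C \<longleftrightarrow>
     Linear_order C \<and> order_dense C \<and> complete_order C \<and>
     (has_max C \<longleftrightarrow> has_max Z) \<and> (has_min C \<longleftrightarrow> has_min Z) \<and>
     (\<exists>e. e ` Field Z \<subseteq> Field C \<and> iso Z (Restr C (e ` Field Z)) e \<and>
          lots_topology C closure_of (e ` Field Z) = Field C)"

section \<open>Lexicographic powers\<close>

text \<open>
  Ordinals are represented by well-orders, so \<open>underS r i\<close> is the set of \<open>j < i\<close> and
  \<open>underS r i \<noteq> {}\<close> says \<open>0 < i\<close>.  The empty well-order, i.e. the ordinal 0, does not count
  as a limit.
\<close>

definition countable_limit_ordinal :: "'i rel \<Rightarrow> bool" where
  "countable_limit_ordinal r \<longleftrightarrow>
     Well_order r \<and> countable (Field r) \<and> Field r \<noteq> {} \<and> (\<forall>i \<in> Field r. aboveS r i \<noteq> {})"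

definition power_points :: "real set \<Rightarrow> 'i rel \<Rightarrow> ('i \<Rightarrow> real) set" where
  "power_points X r =
     {x \<in> Field r \<rightarrow>\<^sub>E X. \<forall>i \<in> Field r. underS r i \<noteq> {} \<longrightarrow> -1 \<le> x i \<and> x i \<le> 1}"

definition lex_power :: "real set \<Rightarrow> 'i rel \<Rightarrow> ('i \<Rightarrow> real) rel" where
  "lex_power X r =
     {(x, y). x \<in> power_points X r \<and> y \<in> power_points X r \<and>
        (x = y \<or> (\<exists>i \<in> Field r. (\<forall>j \<in> underS r i. x j = y j) \<and> x i < y i))}"

section \<open>Hart-van Mill collections\<close>

definition cantor_set :: "real set \<Rightarrow> bool" where
  "cantor_set K \<longleftrightarrow> K homeomorphic (UNIV :: (nat \<Rightarrow> bool) set)"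

definition bi_bernstein :: "real set \<Rightarrow> bool" where
  "bi_bernstein Y \<longleftrightarrow> (\<forall>K. cantor_set K \<longrightarrow> Y \<inter> K \<noteq> {} \<and> (- Y) \<inter> K \<noteq> {})"

definition rational_affine_maps :: "(real \<Rightarrow> real) set" where
  "rational_affine_maps = {(\<lambda>t. a * t + b) | a b. a \<in> \<rat> \<and> b \<in> \<rat> \<and> a > 0}"

definition has_card_continuum :: "'a set \<Rightarrow> bool" where
  "has_card_continuum A \<longleftrightarrow> A \<approx> (UNIV :: nat set set)"

definition hart_van_mill :: "real set set \<Rightarrow> real set \<Rightarrow> bool" where
  "hart_van_mill H V \<longleftrightarrow>
     H \<noteq> {} \<and>
     \<rat> \<subseteq> V \<and>
     (\<forall>Y \<in> insert V H. bi_bernstein Y \<and> (\<forall>g \<in> rational_affine_maps. g ` Y = Y)) \<and>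
     pairwise disjnt (insert V H) \<and>
     (\<forall>Y \<in> H. uminus ` Y \<in> H \<and> uminus ` Y \<noteq> Y) \<and>
     (\<forall>f Y. mono f \<and> Y \<in> H \<and> has_card_continuum (f ` Y - Y) \<longrightarrow>
        has_card_continuum (f ` Y \<inter> V))"

definition hvm_space :: "real set set \<Rightarrow> real set" where
  "hvm_space J = - \<Union>J"

section \<open>Existence of completions\<close>

lemma linear_order_facts:
  assumes "Linear_order r"
  shows "x \<in> Field r \<Longrightarrow> (x, x) \<in> r"
    and "(x, y) \<in> r \<Longrightarrow> (y, z) \<in> r \<Longrightarrow> (x, z) \<in> r"
    and "(x, y) \<in> r \<Longrightarrow> (y, x) \<in> r \<Longrightarrow> x = y"
    and "x \<in> Field r \<Longrightarrow> y \<in> Field r \<Longrightarrow> (x, y) \<in> r \<or> (y, x) \<in> r"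
proof -
  have *: "refl_on (Field r) r" "trans r" "antisym r" "total_on (Field r) r"
    using assms by (auto simp: linear_order_on_def partial_order_on_def preorder_on_def)
  show refl: "x \<in> Field r \<Longrightarrow> (x, x) \<in> r" for x
    using *(1) by (rule refl_onD)
  show "(x, y) \<in> r \<Longrightarrow> (y, z) \<in> r \<Longrightarrow> (x, z) \<in> r"
    using *(2) by (rule transD)
  show "(x, y) \<in> r \<Longrightarrow> (y, x) \<in> r \<Longrightarrow> x = y"
    using *(3) by (rule antisymD)
  show "x \<in> Field r \<Longrightarrow> y \<in> Field r \<Longrightarrow> (x, y) \<in> r \<or> (y, x) \<in> r"
    using *(4) refl unfolding total_on_def by metis
qed

lemma lots_closure_of_eq:
  assumes lin: "Linear_order r" and W: "W \<subseteq> Field r" "W \<noteq> {}"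
    and dense: "\<And>x y. (x, y) \<in> r - Id \<Longrightarrow> \<exists>w \<in> W. (x, w) \<in> r - Id \<and> (w, y) \<in> r - Id"
  shows "lots_topology r closure_of W = Field r"
proof -
  let ?B = "insert (Field r) (underS r ` Field r \<union> aboveS r ` Field r)"
  have tr: "\<And>x y z. (x, y) \<in> r \<Longrightarrow> (y, z) \<in> r \<Longrightarrow> (x, z) \<in> r"
    and an: "\<And>x y. (x, y) \<in> r \<Longrightarrow> (y, x) \<in> r \<Longrightarrow> x = y"
    and tot: "\<And>x y. x \<in> Field r \<Longrightarrow> y \<in> Field r \<Longrightarrow> (x, y) \<in> r \<or> (y, x) \<in> r"
    using linear_order_facts[OF lin] by metis+
  define R where "R U x \<longleftrightarrow> (\<forall>y. (x, y) \<in> r - Id \<longrightarrow>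
      (\<exists>z. (x, z) \<in> r - Id \<and> (z, y) \<in> r \<and> (\<forall>w. (x, w) \<in> r - Id \<and> (w, z) \<in> r - Id \<longrightarrow> w \<in> U)))"
    for U x
  define L where "L U x \<longleftrightarrow> (\<forall>y. (y, x) \<in> r - Id \<longrightarrow>
      (\<exists>z. (z, x) \<in> r - Id \<and> (y, z) \<in> r \<and> (\<forall>w. (w, x) \<in> r - Id \<and> (z, w) \<in> r - Id \<longrightarrow> w \<in> U)))"
    for U x
  have fld: "\<And>x y. (x, y) \<in> r \<Longrightarrow> x \<in> Field r \<and> y \<in> Field r"
    by (auto simp: Field_def)
  have open_RL: "\<forall>x \<in> U. R U x \<and> L U x" if "generate_topology_on ?B U" for U
    using that
  proof induction
    case Empty
    then show ?case by simp
  next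
    case (Int a b)
    show ?case
    proof (intro ballI conjI)
      fix x assume "x \<in> a \<inter> b"
      then have ra: "R a x" and rb: "R b x" and la: "L a x" and lb: "L b x"
        using Int by auto
      show "R (a \<inter> b) x" unfolding R_def
      proof (intro allI impI)
        fix y assume "(x, y) \<in> r - Id"
        then obtain z where z: "(x, z) \<in> r - Id" "(z, y) \<in> r"
            "\<forall>w. (x, w) \<in> r - Id \<and> (w, z) \<in> r - Id \<longrightarrow> w \<in> a"
          using ra unfolding R_def by blast
        obtain z' where z': "(x, z') \<in> r - Id" "(z', z) \<in> r"
            "\<forall>w. (x, w) \<in> r - Id \<and> (w, z') \<in> r - Id \<longrightarrow> w \<in> b"
          using rb z(1) unfolding R_def by blast
        have "\<forall>w. (w, z') \<in> r - Id \<longrightarrow> (w, z) \<in> r - Id"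
          using z'(2) tr an by blast
        then show "\<exists>z. (x, z) \<in> r - Id \<and> (z, y) \<in> r \<and>
            (\<forall>w. (x, w) \<in> r - Id \<and> (w, z) \<in> r - Id \<longrightarrow> w \<in> a \<inter> b)"
          using z z' tr by (intro exI[of _ z']) blast
      qed
      show "L (a \<inter> b) x" unfolding L_def
      proof (intro allI impI)
        fix y assume "(y, x) \<in> r - Id"
        then obtain z where z: "(z, x) \<in> r - Id" "(y, z) \<in> r"
            "\<forall>w. (w, x) \<in> r - Id \<and> (z, w) \<in> r - Id \<longrightarrow> w \<in> a"
          using la unfolding L_def by blast
        obtain z' where z': "(z', x) \<in> r - Id" "(z, z') \<in> r"
            "\<forall>w. (w, x) \<in> r - Id \<and> (z', w) \<in> r - Id \<longrightarrow> w \<in> b"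
          using lb z(1) unfolding L_def by blast
        have "\<forall>w. (z', w) \<in> r - Id \<longrightarrow> (z, w) \<in> r - Id"
          using z'(2) tr an by blast
        then show "\<exists>z. (z, x) \<in> r - Id \<and> (y, z) \<in> r \<and>
            (\<forall>w. (w, x) \<in> r - Id \<and> (z, w) \<in> r - Id \<longrightarrow> w \<in> a \<inter> b)"
          using z z' tr by (intro exI[of _ z']) blast
      qed
    qed
  next
    case (UN K)
    show ?case
    proof (intro ballI conjI)
      fix x assume "x \<in> \<Union>K"
      then obtain k where k: "k \<in> K" "x \<in> k" by blast
      then have "R k x" "L k x" using UN by auto
      then show "R (\<Union>K) x" "L (\<Union>K) x"
        unfolding R_def L_def using k(1) by (meson UnionI)+
    qed
  next
    case (Basis s)
    then consider "s = Field r" | a where "a \<in> Field r" "s = underS r a"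
      | a where "a \<in> Field r" "s = aboveS r a" by blast
    then show ?case
    proof cases
      case 1
      then have "R s x" "L s x" for x
        using fld tot unfolding R_def L_def by (metis DiffD1)+
      then show ?thesis by blast
    next
      case 2
      show ?thesis
      proof (intro ballI conjI)
        fix x assume "x \<in> s"
        then have x: "(x, a) \<in> r - Id" using 2 by (auto simp: underS_def)
        show "R s x" unfolding R_def
        proof (intro allI impI)
          fix y assume y: "(x, y) \<in> r - Id"
          obtain z where "z \<in> {a, y}" "(z, y) \<in> r" "(z, a) \<in> r"
            using tot[of a y] tot[of a a] tot[of y y] fld x y by blast
          then show "\<exists>z. (x, z) \<in> r - Id \<and> (z, y) \<in> r \<and>
              (\<forall>w. (x, w) \<in> r - Id \<and> (w, z) \<in> r - Id \<longrightarrow> w \<in> s)"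
            using x y 2 tr an unfolding underS_def by (intro exI[of _ z]) blast
        qed
        show "L s x" unfolding L_def
        proof (intro allI impI)
          fix y assume y: "(y, x) \<in> r - Id"
          then show "\<exists>z. (z, x) \<in> r - Id \<and> (y, z) \<in> r \<and>
              (\<forall>w. (w, x) \<in> r - Id \<and> (z, w) \<in> r - Id \<longrightarrow> w \<in> s)"
            using x 2 tr an tot[of y y] fld unfolding underS_def by (intro exI[of _ y]) blast
        qed
      qed
    next
      case 3
      show ?thesis
      proof (intro ballI conjI)
        fix x assume "x \<in> s"
        then have x: "(a, x) \<in> r - Id" using 3 by (auto simp: aboveS_def)
        show "L s x" unfolding L_def
        proof (intro allI impI)
          fix y assume y: "(y, x) \<in> r - Id"
          obtain z where "z \<in> {a, y}" "(y, z) \<in> r" "(a, z) \<in> r"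
            using tot[of a y] tot[of a a] tot[of y y] fld x y by blast
          then show "\<exists>z. (z, x) \<in> r - Id \<and> (y, z) \<in> r \<and>
              (\<forall>w. (w, x) \<in> r - Id \<and> (z, w) \<in> r - Id \<longrightarrow> w \<in> s)"
            using x y 3 tr an unfolding aboveS_def by (intro exI[of _ z]) blast
        qed
        show "R s x" unfolding R_def
        proof (intro allI impI)
          fix y assume y: "(x, y) \<in> r - Id"
          then show "\<exists>z. (x, z) \<in> r - Id \<and> (z, y) \<in> r \<and>
              (\<forall>w. (x, w) \<in> r - Id \<and> (w, z) \<in> r - Id \<longrightarrow> w \<in> s)"
            using x 3 tr an tot[of y y] fld unfolding aboveS_def by (intro exI[of _ y]) blast
        qed
      qed
    qed
  qed
  have top: "topspace (lots_topology r) = Field r"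
    unfolding lots_topology_def by (auto simp: underS_def aboveS_def Field_def)
  have "\<exists>w \<in> W. w \<in> U" if U: "openin (lots_topology r) U" and x: "x \<in> U" for U x
  proof -
    have gen: "generate_topology_on ?B U"
      using U unfolding lots_topology_def openin_topology_generated_by_iff .
    have xF: "x \<in> Field r" using U x top openin_subset by blast
    have RL: "R U x" "L U x" using open_RL[OF gen] x by auto
    consider y where "(x, y) \<in> r - Id" | y where "(y, x) \<in> r - Id" | "Field r = {x}"
      using tot xF by blast
    then show ?thesis
    proof cases
      case 1
      then show ?thesis using RL(1) dense unfolding R_def by meson
    next
      case 2
      then show ?thesis using RL(2) dense unfolding L_def by meson
    next
      case 3
      then have "x \<in> W" using W by (metis subset_singletonD insertI1)
      then show ?thesis using x by blast
    qed
  qed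
  then show ?thesis
    unfolding closure_of_def top using W by blast
qed

text \<open>
  The points of the completion are the downward closed sets without a last element that lie
  between two of the sets \<open>underS Z a\<close>, ordered by inclusion.
\<close>

lemma completion_exists:
  fixes Z :: "'a rel"
  assumes lin: "Linear_order Z" and dns: "order_dense Z"
  shows "\<exists>C :: 'a set rel. is_completion Z C"
proof -
  have rf: "\<And>x. x \<in> Field Z \<Longrightarrow> (x, x) \<in> Z"
    and tr: "\<And>x y z. (x, y) \<in> Z \<Longrightarrow> (y, z) \<in> Z \<Longrightarrow> (x, z) \<in> Z"
    and an: "\<And>x y. (x, y) \<in> Z \<Longrightarrow> (y, x) \<in> Z \<Longrightarrow> x = y"
    and tot: "\<And>x y. x \<in> Field Z \<Longrightarrow> y \<in> Field Z \<Longrightarrow> (x, y) \<in> Z \<or> (y, x) \<in> Z"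
    using linear_order_facts[OF lin] by metis+
  have fld: "\<And>x y. (x, y) \<in> Z \<Longrightarrow> x \<in> Field Z \<and> y \<in> Field Z"
    by (auto simp: Field_def)
  have dn: "\<exists>z. (x, z) \<in> Z \<and> x \<noteq> z \<and> (z, y) \<in> Z \<and> z \<noteq> y" if "(x, y) \<in> Z" "x \<noteq> y" for x y
    using dns that unfolding order_dense_def by blast
  let ?S = "underS Z"
  define D where "D L \<longleftrightarrow> L \<subseteq> Field Z \<and> (\<forall>x \<in> L. \<forall>y. (y, x) \<in> Z \<longrightarrow> y \<in> L) \<and>
      (\<forall>x \<in> L. \<exists>y \<in> L. (x, y) \<in> Z \<and> x \<noteq> y)" for L
  define P where "P = {L. D L \<and> (\<exists>a \<in> Field Z. ?S a \<subseteq> L) \<and> (\<exists>b \<in> Field Z. L \<subseteq> ?S b)}"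
  define C where "C = {(L, M). L \<in> P \<and> M \<in> P \<and> L \<subseteq> M}"
  have FC: "Field C = P" unfolding C_def Field_def by auto
  have above: "B \<in> Above C T \<longleftrightarrow> B \<in> P \<and> (\<forall>L \<in> T. L \<subseteq> B)" if "T \<subseteq> P" for B T
    using that unfolding Above_def FC unfolding C_def by auto
  have under: "B \<in> Under C T \<longleftrightarrow> B \<in> P \<and> (\<forall>L \<in> T. B \<subseteq> L)" if "T \<subseteq> P" for B T
    using that unfolding Under_def FC unfolding C_def by auto
  have DS: "D (?S a)" if "a \<in> Field Z" for a
    unfolding D_def
  proof (intro conjI ballI allI impI)
    show "?S a \<subseteq> Field Z" by (auto simp: underS_def dest: fld)
    fix x assume x: "x \<in> ?S a"
    show "y \<in> ?S a" if "(y, x) \<in> Z" for y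
      using that x tr an by (auto simp: underS_def)
    show "\<exists>y \<in> ?S a. (x, y) \<in> Z \<and> x \<noteq> y"
      using dn[of x a] x by (auto simp: underS_def)
  qed
  have SP: "?S a \<in> P" if "a \<in> Field Z" for a
    unfolding P_def using DS that by blast
  have cmp: "M \<subseteq> ?S x" if "D M" "x \<in> Field Z" "x \<notin> M" for M x
  proof
    fix y assume "y \<in> M"
    then show "y \<in> ?S x" using that tot[of x y] unfolding D_def underS_def by blast
  qed
  have sub: "?S x \<subseteq> M" if "D M" "x \<in> M" for M x
    using that unfolding D_def underS_def by blast
  have Smono: "?S a \<subseteq> ?S b \<longleftrightarrow> (a, b) \<in> Z" if "a \<in> Field Z" "b \<in> Field Z" for a b
  proof
    assume "?S a \<subseteq> ?S b"
    then have "b \<notin> ?S a" by (auto simp: underS_def)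
    then show "(a, b) \<in> Z"
      using tot[of a b] that rf[of a] unfolding underS_def by blast
  next
    assume ab: "(a, b) \<in> Z"
    show "?S a \<subseteq> ?S b"
    proof
      fix x assume "x \<in> ?S a"
      then have "(x, a) \<in> Z" "x \<noteq> a" by (auto simp: underS_def)
      then have "(x, b) \<in> Z" "x \<noteq> b" using tr[OF _ ab] an[OF _ ab] by auto
      then show "x \<in> ?S b" by (simp add: underS_def)
    qed
  qed
  have comparable: "L \<subseteq> M \<or> M \<subseteq> L" if "D L" "D M" for L M
  proof (rule ccontr)
    assume "\<not> ?thesis"
    then obtain x where x: "x \<in> L" "x \<notin> M" "\<not> M \<subseteq> L" by blast
    have "x \<in> Field Z" using x(1) that(1) unfolding D_def by blast
    then have "M \<subseteq> ?S x" using cmp that(2) x(2) by simp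
    then show False using sub[OF that(1) x(1)] x(3) by simp
  qed
  have linC: "Linear_order C"
    unfolding linear_order_on_def partial_order_on_def preorder_on_def FC
  proof (intro conjI)
    show "C \<subseteq> P \<times> P" unfolding C_def by auto
    show "refl_on P C" unfolding C_def refl_on_def by auto
    show "trans C" unfolding C_def trans_def by auto
    show "antisym C" unfolding C_def antisym_def by auto
    show "total_on P C"
      using comparable unfolding C_def P_def total_on_def by blast
  qed
  have between: "\<exists>w \<in> ?S ` Field Z. (L, w) \<in> C - Id \<and> (w, M) \<in> C - Id" if "(L, M) \<in> C - Id" for L M
  proof -
    have L: "L \<in> P" "D L" and M: "M \<in> P" "D M" and LM: "L \<subset> M"
      using that by (auto simp: C_def P_def)
    obtain x where x: "x \<in> M" "x \<notin> L" using LM by blast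
    obtain y where y: "y \<in> M" "(x, y) \<in> Z" "x \<noteq> y" using x M unfolding D_def by blast
    have F: "x \<in> Field Z" "y \<in> Field Z" using x y M unfolding D_def by auto
    have "L \<subseteq> ?S x" using cmp L x F by blast
    also have "?S x \<subseteq> ?S y" using Smono F y by blast
    finally have 1: "L \<subseteq> ?S y" .
    have "x \<in> ?S y" using y by (auto simp: underS_def)
    then have "L \<noteq> ?S y" using x by blast
    moreover have "?S y \<noteq> M" using y(1) by (auto simp: underS_def)
    moreover have "?S y \<subseteq> M" using sub M y by blast
    ultimately have "(L, ?S y) \<in> C - Id \<and> (?S y, M) \<in> C - Id"
      using 1 L M SP[OF F(2)] unfolding C_def by auto
    then show ?thesis using F by blast
  qed
  have densC: "order_dense C"
    unfolding order_dense_def using between by blast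
  have sup: "is_supremum C T (\<Union>T)" if T: "T \<subseteq> P" "T \<noteq> {}" "Above C T \<noteq> {}" for T
  proof -
    have TD: "\<And>L. L \<in> T \<Longrightarrow> D L" using T unfolding P_def by blast
    have dU: "D (\<Union>T)" unfolding D_def
    proof (intro conjI ballI allI impI)
      show "\<Union>T \<subseteq> Field Z" using TD unfolding D_def by blast
      fix x assume "x \<in> \<Union>T"
      then obtain L where L: "L \<in> T" "x \<in> L" by blast
      show "y \<in> \<Union>T" if "(y, x) \<in> Z" for y
        using that L TD unfolding D_def by blast
      show "\<exists>y \<in> \<Union>T. (x, y) \<in> Z \<and> x \<noteq> y"
        using L TD unfolding D_def by blast
    qed
    obtain B where B: "B \<in> P" "\<And>L. L \<in> T \<Longrightarrow> L \<subseteq> B"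
      using T(3) above[OF T(1)] by blast
    obtain b where b: "b \<in> Field Z" "B \<subseteq> ?S b" using B unfolding P_def by blast
    obtain L a where a: "L \<in> T" "a \<in> Field Z" "?S a \<subseteq> L" using T unfolding P_def by blast
    have UP: "\<Union>T \<in> P"
      unfolding P_def using dU a b B by blast
    have "\<Union>T \<in> Above C T"
      using UP above[OF T(1)] by blast
    moreover have "(\<Union>T, V) \<in> C" if "V \<in> Above C T" for V
      using that UP above[OF T(1)] unfolding C_def by blast
    ultimately show ?thesis unfolding is_supremum_def by blast
  qed
  have compl: "complete_order C"
    unfolding complete_order_def FC
  proof (intro allI impI, elim conjE, rule conjI)
    fix T assume T: "T \<subseteq> P" "T \<noteq> {}" "Above C T \<noteq> {}" "Under C T \<noteq> {}"
    show "\<exists>u. is_supremum C T u" using sup T by blast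
    have U: "Under C T \<subseteq> P" unfolding Under_def FC by blast
    have TA: "T \<subseteq> Above C (Under C T)"
      using T(1) above[OF U] under[OF T(1)] by blast
    then have su: "is_supremum C (Under C T) (\<Union>(Under C T))"
      using sup[OF U T(4)] T(2) by blast
    have "\<Union>(Under C T) \<in> P"
      using su above[OF U] unfolding is_supremum_def by simp
    then have inU: "\<Union>(Under C T) \<in> Under C T"
      using under[OF T(1)] by blast
    have "(V, \<Union>(Under C T)) \<in> C" if "V \<in> Under C T" for V
      using that inU U unfolding C_def by auto
    then have "is_infimum C T (\<Union>(Under C T))"
      using inU unfolding is_infimum_def by simp
    then show "\<exists>u. is_infimum C T u" by blast
  qed
  have mx: "has_max C \<longleftrightarrow> has_max Z"
  proof
    assume "has_max C"
    then obtain M where M: "M \<in> P" "\<And>L. L \<in> P \<Longrightarrow> L \<subseteq> M"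
      using above[of P] unfolding has_max_def FC by blast
    obtain b where b: "b \<in> Field Z" "M \<subseteq> ?S b" using M unfolding P_def by blast
    have "(a, b) \<in> Z" if "a \<in> Field Z" for a
      using M(2)[OF SP[OF that]] b Smono[OF that b(1)] by blast
    then show "has_max Z" unfolding has_max_def Above_def using b by blast
  next
    assume "has_max Z"
    then obtain b where b: "b \<in> Field Z" "\<And>a. a \<in> Field Z \<Longrightarrow> (a, b) \<in> Z"
      unfolding has_max_def Above_def by blast
    have "L \<subseteq> ?S b" if "L \<in> P" for L
      using that b Smono unfolding P_def by blast
    then show "has_max C"
      using SP[OF b(1)] above[of P] unfolding has_max_def FC by blast
  qed
  have mn: "has_min C \<longleftrightarrow> has_min Z"
  proof
    assume "has_min C"
    then obtain M where M: "M \<in> P" "\<And>L. L \<in> P \<Longrightarrow> M \<subseteq> L"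
      using under[of P] unfolding has_min_def FC by blast
    obtain b where b: "b \<in> Field Z" "?S b \<subseteq> M" using M unfolding P_def by blast
    have "(b, a) \<in> Z" if "a \<in> Field Z" for a
      using M(2)[OF SP[OF that]] b Smono[OF b(1) that] by blast
    then show "has_min Z" unfolding has_min_def Under_def using b by blast
  next
    assume "has_min Z"
    then obtain b where b: "b \<in> Field Z" "\<And>a. a \<in> Field Z \<Longrightarrow> (b, a) \<in> Z"
      unfolding has_min_def Under_def by blast
    have "?S b \<subseteq> L" if "L \<in> P" for L
      using that b Smono unfolding P_def by blast
    then show "has_min C"
      using SP[OF b(1)] under[of P] unfolding has_min_def FC by blast
  qed
  have eF: "?S ` Field Z \<subseteq> Field C" using SP FC by blast
  have FR: "Field (Restr C (?S ` Field Z)) = ?S ` Field Z"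
    using SP unfolding Field_def C_def by auto
  have isoe: "iso Z (Restr C (?S ` Field Z)) ?S"
    unfolding iso_iff2 FR
  proof (intro conjI ballI)
    show "bij_betw ?S (Field Z) (?S ` Field Z)"
      unfolding bij_betw_def
    proof (intro conjI inj_onI refl)
      fix a b assume F: "a \<in> Field Z" "b \<in> Field Z" and "?S a = ?S b"
      then have "(a, b) \<in> Z" "(b, a) \<in> Z" using Smono[of a b] Smono[of b a] by auto
      then show "a = b" by (rule an)
    qed
    fix a b assume "a \<in> Field Z" "b \<in> Field Z"
    then show "(a, b) \<in> Z \<longleftrightarrow> (?S a, ?S b) \<in> Restr C (?S ` Field Z)"
      using Smono[of a b] SP unfolding C_def by auto
  qed
  have clos: "lots_topology C closure_of (?S ` Field Z) = Field C"
  proof (cases "Field Z = {}")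
    case True
    then have "Field C = {}" unfolding FC P_def by blast
    then show ?thesis using True by simp
  next
    case False
    then show ?thesis using lots_closure_of_eq[OF linC eF _ between] by blast
  qed
  have "is_completion Z C"
    unfolding is_completion_def using linC densC compl mx mn eF isoe clos by blast
  then show ?thesis by blast
qed

lemma Field_lex_power: "Field (lex_power X r) = power_points X r"
  unfolding lex_power_def Field_def by auto

lemma linear_order_lex_power:
  assumes wo: "Well_order r"
  shows "Linear_order (lex_power X r)"
proof -
  have lin: "Linear_order r" and wf: "wf (r - Id)"
    using wo by (auto simp: well_order_on_def)
  note ord = linear_order_facts[OF lin]
  let ?P = "power_points X r"
  define ls where "ls i x y \<longleftrightarrow> i \<in> Field r \<and> (\<forall>j \<in> underS r i. x j = y j) \<and> x i < y i"
    for i :: 'a and x y :: "'a \<Rightarrow> real"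
  have L: "(x, y) \<in> lex_power X r \<longleftrightarrow> x \<in> ?P \<and> y \<in> ?P \<and> (x = y \<or> (\<exists>i. ls i x y))" for x y
    unfolding lex_power_def ls_def by blast
  have under: "j \<in> underS r i \<or> j = i \<or> i \<in> underS r j" if "i \<in> Field r" "j \<in> Field r" for i j
    using ord(4)[OF that] unfolding underS_def by blast
  have under_trans: "k \<in> underS r i" if "k \<in> underS r j" "j \<in> underS r i" for i j k
    using that ord(2)[of k j i] ord(3)[of j i] unfolding underS_def by auto
  have ls_trans: "\<exists>k. ls k x z" if ls: "ls i x y" "ls j y z" for i j x y z
  proof -
    consider "j \<in> underS r i" | "j = i" | "i \<in> underS r j"
      using under[of i j] ls unfolding ls_def by blast
    then show ?thesis
    proof cases
      case 1
      then have "ls j x z" using that under_trans[OF _ 1] unfolding ls_def by auto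
      then show ?thesis by blast
    next
      case 2
      then have "ls i x z" using that unfolding ls_def by auto
      then show ?thesis by blast
    next
      case 3
      then have "ls i x z" using that under_trans[OF _ 3] unfolding ls_def by auto
      then show ?thesis by blast
    qed
  qed
  have ls_irrefl: "\<not> ls i x x" for i x unfolding ls_def by simp
  have total: "(\<exists>i. ls i x y) \<or> (\<exists>i. ls i y x)" if "x \<in> ?P" "y \<in> ?P" "x \<noteq> y" for x y
  proof -
    let ?D = "{i \<in> Field r. x i \<noteq> y i}"
    obtain i0 where i0: "x i0 \<noteq> y i0" using \<open>x \<noteq> y\<close> by blast
    have ext: "x \<in> extensional (Field r)" "y \<in> extensional (Field r)"
      using that unfolding power_points_def PiE_def by auto
    have "i0 \<in> ?D"
      using i0 extensional_arb[OF ext(1), of i0] extensional_arb[OF ext(2), of i0]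
      by (cases "i0 \<in> Field r") auto
    then obtain i where i: "i \<in> ?D" "\<And>j. (j, i) \<in> r - Id \<Longrightarrow> j \<notin> ?D"
      by (rule wfE_min[OF wf]) (rule that)
    have "x j = y j" if "j \<in> underS r i" for j
      using i(2)[of j] that unfolding underS_def Field_def by blast
    then have "ls i x y \<or> ls i y x"
      using i(1) unfolding ls_def by (auto simp: neq_iff)
    then show ?thesis by blast
  qed
  show ?thesis
    unfolding linear_order_on_def partial_order_on_def preorder_on_def Field_lex_power
  proof (intro conjI)
    show "lex_power X r \<subseteq> ?P \<times> ?P" using L by auto
    show "refl_on ?P (lex_power X r)" using L by (auto simp: refl_on_def)
    show "trans (lex_power X r)"
    proof (rule transI)
      fix x y z assume "(x, y) \<in> lex_power X r" "(y, z) \<in> lex_power X r"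
      then show "(x, z) \<in> lex_power X r" unfolding L using ls_trans by blast
    qed
    show "antisym (lex_power X r)"
    proof (rule antisymI)
      fix x y assume "(x, y) \<in> lex_power X r" "(y, x) \<in> lex_power X r"
      then show "x = y" unfolding L using ls_trans ls_irrefl by metis
    qed
    show "total_on ?P (lex_power X r)"
      using total unfolding total_on_def L by blast
  qed
qed

lemma order_dense_lex_power:
  assumes X: "\<rat> \<subseteq> X"
  shows "order_dense (lex_power X r)"
  unfolding order_dense_def
proof (intro allI impI)
  fix x y assume "(x, y) \<in> lex_power X r - Id"
  then obtain i where x: "x \<in> power_points X r" and y: "y \<in> power_points X r"
    and i: "i \<in> Field r" "\<forall>j \<in> underS r i. x j = y j" "x i < y i"
    unfolding lex_power_def by auto
  obtain q where q: "q \<in> \<rat>" "x i < q" "q < y i"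
    using Rats_dense_in_real[OF i(3)] by blast
  let ?z = "x(i := q)"
  have bnd: "-1 \<le> q \<and> q \<le> 1" if "underS r i \<noteq> {}"
  proof -
    have "-1 \<le> x i" "y i \<le> 1"
      using x y i(1) that unfolding power_points_def by blast+
    then show ?thesis using q by linarith
  qed
  have "?z \<in> Field r \<rightarrow>\<^sub>E X"
    using x q(1) X i(1) unfolding power_points_def PiE_def extensional_def by auto
  then have z: "?z \<in> power_points X r"
    using x bnd unfolding power_points_def by auto
  have zu: "?z j = x j" if "j \<in> underS r i" for j
    using that unfolding underS_def by auto
  have "(x, ?z) \<in> lex_power X r"
    unfolding lex_power_def using x z i zu q by (auto intro!: bexI[of _ i])
  moreover have "(?z, y) \<in> lex_power X r"
    unfolding lex_power_def using y z i zu q by (auto intro!: bexI[of _ i])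
  moreover have "x \<noteq> ?z" "?z \<noteq> y"
    using q by (metis fun_upd_same less_irrefl)+
  ultimately show "\<exists>z. (x, z) \<in> lex_power X r - Id \<and> (z, y) \<in> lex_power X r - Id"
    by blast
qed

lemma hvm_completion_exists:
  fixes r :: "'i rel"
  assumes "hart_van_mill H V" "J \<subseteq> H" "Well_order r"
  shows "\<exists>C :: ('i \<Rightarrow> real) set rel. is_completion (lex_power (hvm_space J) r) C"
proof (rule completion_exists)
  have V: "\<rat> \<subseteq> V" and disj: "pairwise disjnt (insert V H)"
    and sym: "\<And>Y. Y \<in> H \<Longrightarrow> uminus ` Y \<in> H \<and> uminus ` Y \<noteq> Y"
    using assms(1) by (simp_all add: hart_van_mill_def)
  have "V \<notin> H"
  proof
    assume "V \<in> H"
    then have "disjnt (uminus ` V) V"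
      using sym[of V] by (intro pairwiseD[OF disj]) auto
    moreover have "0 \<in> V" using V Rats_0 by blast
    then have "0 \<in> uminus ` V" by force
    ultimately show False using \<open>0 \<in> V\<close> unfolding disjnt_def by blast
  qed
  then have "disjnt V Y" if "Y \<in> J" for Y
    using that assms(2) by (intro pairwiseD[OF disj]) auto
  then have "\<rat> \<subseteq> hvm_space J"
    using V unfolding hvm_space_def disjnt_def by blast
  then show "order_dense (lex_power (hvm_space J) r)"
    by (rule order_dense_lex_power)
  show "Linear_order (lex_power (hvm_space J) r)"
    using assms(3) by (rule linear_order_lex_power)
qed

end

theory Submission
  imports Defs
begin

text \<open>
  An isomorphism of the completions makes both lexicographic powers dense in one order.  Taking
  first coordinates of the first power then gives a monotone map \<open>h\<close> from the second power
  \<open>X\<^sub>1\<^sub>\<beta>\<close> to \<open>\<real>\<close> whose fibre over \<open>t\<close> has at least two points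
  if \<open>t \<in> X\<close> and at most one otherwise.  For a cone, the points of the second power with a given
  prefix of length \<open>i\<close>, recording the largest \<open>i\<close>-th coordinate of a point \<open>z\<close> in it with
  \<open>h z \<le> t\<close> gives an order map \<open>f\<close> of \<open>\<real>\<close>.  A gap \<open>y\<close> of \<open>X\<close>
  cannot be the only point with a value \<open>f y \<in> X\<^sub>1\<close>, since the cone below that value would
  be mapped to \<open>y\<close>.  So for \<open>Y \<in> J\<close> the set \<open>f ` Y \<inter> X\<^sub>1\<close> is countable, and if \<open>f\<close> has
  uncountable range, condition (v) forces \<open>Y \<in> J1\<close>.

  Some \<open>f\<close> has uncountable range: otherwise, by induction on \<open>i\<close>, all but countably many
  reals lie strictly inside the image of a cone of level \<open>i\<close>.  As there are only countably many
  levels, some \<open>t \<in> X\<close> lies inside such an image at every level, which puts the whole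
  fibre over \<open>t\<close> into one cone at every level, so the fibre is a single point.
\<close>

section \<open>Bernstein sets and monotone maps\<close>

text \<open>Points of \<open>A\<close> caught in a rational interval on which \<open>f\<close> takes
  only countably many values contribute countably many values in total. Every other point can be
  enclosed in an arbitrarily short interval that keeps an uncountable image.\<close>

lemma uncountable_image_split:
  fixes f :: "real \<Rightarrow> real"
  assumes f: "mono f" and big: "uncountable (f ` (A \<inter> {a..b}))" and e: "0 < e"
  obtains c d c' d' where "a \<le> c" "d < c'" "d' \<le> b" "d - c \<le> e" "d' - c' \<le> e" "f d < f c'"
    "uncountable (f ` (A \<inter> {c..d}))" "uncountable (f ` (A \<inter> {c'..d'}))"
proof -
  let ?S = "A \<inter> {a..b}"
  define Q where "Q = {(p, q) \<in> \<rat> \<times> \<rat>. countable (f ` (?S \<inter> {p..q}))}"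
  define N where "N = (\<Union>(p, q) \<in> Q. ?S \<inter> {p..q})"
  have "countable Q"
    unfolding Q_def by (rule countable_subset[of _ "\<rat> \<times> \<rat>"]) (auto simp: countable_rat)
  moreover have "f ` N = (\<Union>(p, q) \<in> Q. f ` (?S \<inter> {p..q}))"
    unfolding N_def by auto
  ultimately have "countable (f ` N)"
    by (auto simp: Q_def)
  moreover have "f ` ?S \<subseteq> f ` N \<union> f ` (?S - N)" by auto
  ultimately have "uncountable (f ` (?S - N))"
    using big by (meson countable_Un countable_subset)
  then have "infinite (f ` (?S - N))" using countable_finite by blast
  \<comment> \<open>Four points are taken: the outer two are enclosed in the new intervals, and the
    inner two force the values on these intervals strictly apart.\<close>
  then obtain T where T: "T \<subseteq> f ` (?S - N)" "finite T" "card T = 4"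
    using infinite_arbitrarily_large by metis
  define v where "v n = sorted_list_of_set T ! n" for n
  have len: "length (sorted_list_of_set T) = 4" using T by simp
  have vT: "v n \<in> f ` (?S - N)" if "n < 4" for n
  proof -
    have "v n \<in> set (sorted_list_of_set T)" using that len unfolding v_def by simp
    then show ?thesis using T(1,2) by auto
  qed
  have vlt: "v m < v n" if "m < n" "n < 4" for m n
    using that len unfolding v_def
    by (intro sorted_wrt_nth_less[OF strict_sorted_list_of_set]) auto
  obtain t where t: "t n \<in> ?S - N" "f (t n) = v n" if "n < 4" for n
    using vT unfolding image_iff by metis
  have tlt: "t m < t n" if "m < n" "n < 4" for m n
  proof (rule ccontr)
    assume "\<not> ?thesis"
    then have "f (t n) \<le> f (t m)" using f by (simp add: monoD)
    then show False using vlt[OF that] t[of m] t[of n] that by simp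
  qed
  have near: "\<exists>c d. a \<le> c \<and> d \<le> b \<and> l < c \<and> d < u \<and> d - c \<le> e \<and> uncountable (f ` (A \<inter> {c..d}))"
    if x: "x \<in> ?S - N" "l < x" "x < u" for x l u
  proof -
    obtain p where p: "p \<in> \<rat>" "max l (x - e/2) < p" "p < x"
      using Rats_dense_in_real[of "max l (x - e/2)" x] x e by auto
    obtain q where q: "q \<in> \<rat>" "x < q" "q < min u (x + e/2)"
      using Rats_dense_in_real[of x "min u (x + e/2)"] x e by auto
    have "(p, q) \<notin> Q" using x p q unfolding N_def by fastforce
    then have "uncountable (f ` (?S \<inter> {p..q}))" using p q unfolding Q_def by auto
    moreover have "?S \<inter> {p..q} = A \<inter> {max a p..min b q}" by auto
    ultimately show ?thesis
      using p q by (intro exI[of _ "max a p"] exI[of _ "min b q"]) auto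
  qed
  obtain c d where cd: "a \<le> c" "d < t 1" "d - c \<le> e" "uncountable (f ` (A \<inter> {c..d}))"
    using near[of "t 0" "t 0 - 1" "t 1"] t[of 0] tlt[of 0 1] by auto
  obtain c' d' where cd': "t 2 < c'" "d' \<le> b" "d' - c' \<le> e" "uncountable (f ` (A \<inter> {c'..d'}))"
    using near[of "t 3" "t 2" "t 3 + 1"] t[of 3] tlt[of 2 3] by auto
  have "d < c'" using cd cd' tlt[of 1 2] by simp
  moreover have "f d \<le> v 1" "v 2 \<le> f c'" 
    using monoD[OF f, of d "t 1"] monoD[OF f, of "t 2" c'] cd cd' t(2)[of 1] t(2)[of 2] by simp_all
  then have "f d < f c'" using vlt[of 1 2] by simp
  ultimately show ?thesis using that cd cd' by blast
qed

text \<open>Repeated splitting gives a binary tree of shrinking intervals. Each branch converges to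
  a point of the closed set \<open>A\<close>, and branches that part at a node get different values
  because \<open>f\<close> separates the two children of every node.\<close>

lemma cantor_scheme:
  fixes f :: "real \<Rightarrow> real"
  assumes f: "mono f" and A: "closed A" and big: "uncountable (f ` A)"
  obtains g :: "(nat \<Rightarrow> bool) \<Rightarrow> real"
  where "continuous_on UNIV g" "range g \<subseteq> A" "inj (\<lambda>s. f (g s))"
proof -
  define good where "good p \<longleftrightarrow> uncountable (f ` (A \<inter> {fst p..snd p}))" for p
  have good_ne: "\<exists>x \<in> A. fst p \<le> x \<and> x \<le> snd p" if "good p" for p
    using that unfolding good_def by (metis Int_emptyI atLeastAtMost_iff countable_empty image_empty)
  have "\<exists>N. good p \<longrightarrow> (\<forall>b. good (N b) \<and> fst p \<le> fst (N b) \<and> snd (N b) \<le> snd p \<and>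
      snd (N b) - fst (N b) \<le> (1/2)^n) \<and> f (snd (N False)) < f (fst (N True))"
    for p and n :: nat
  proof (cases "good p")
    case True
    then have "uncountable (f ` (A \<inter> {fst p..snd p}))" unfolding good_def .
    moreover have "0 < (1/2::real)^n" by simp
    ultimately
    obtain c d c' d' where h: "fst p \<le> c" "d < c'" "d' \<le> snd p" "d - c \<le> (1/2)^n"
      "d' - c' \<le> (1/2)^n" "f d < f c'" "good (c, d)" "good (c', d')"
      unfolding good_def fst_conv snd_conv by (rule uncountable_image_split[OF f])
    have "c \<le> d" "c' \<le> d'" using good_ne[OF h(7)] good_ne[OF h(8)] by auto
    then show ?thesis
      using h by (intro exI[of _ "\<lambda>b. if b then (c', d') else (c, d)"]) auto
  qed auto
  then obtain N where N: "\<And>p n b. good p \<Longrightarrow> good (N p n b) \<and> fst p \<le> fst (N p n b) \<and>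
      snd (N p n b) \<le> snd p \<and> snd (N p n b) - fst (N p n b) \<le> (1/2)^n"
    and Nlt: "\<And>p n. good p \<Longrightarrow> f (snd (N p n False)) < f (fst (N p n True))"
    by metis
  obtain p0 where p0: "good p0"
  proof -
    have "A \<subseteq> (\<Union>n. A \<inter> {- real n..real n})"
    proof
      fix x assume "x \<in> A"
      moreover obtain n where "\<bar>x\<bar> \<le> real n" using real_arch_simple by blast
      then have "x \<in> {- real n..real n}" by auto
      ultimately show "x \<in> (\<Union>n. A \<inter> {- real n..real n})" by blast
    qed
    then have "f ` A \<subseteq> (\<Union>n. f ` (A \<inter> {- real n..real n}))" by blast
    then obtain n where "uncountable (f ` (A \<inter> {- real n..real n}))"
      using big by (meson countable_UN countable_subset countableI_type)
    then have "good (- real n, real n)" unfolding good_def by simp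
    then show ?thesis by (rule that)
  qed
  \<comment> \<open>\<open>I s n\<close> is the node of depth \<open>n\<close> on the branch
    \<open>s\<close>. It depends only on the first \<open>n\<close> bits, hence is locally constant
    in \<open>s\<close>.\<close>
  define I where "I s = rec_nat p0 (\<lambda>n p. N p n (s n))" for s :: "nat \<Rightarrow> bool"
  have I0: "I s 0 = p0" and IS: "I s (Suc n) = N (I s n) n (s n)" for s n
    unfolding I_def by simp_all
  have Ig: "good (I s n)" for s n
    by (induction n) (auto simp: I0 IS p0 N)
  have Inest: "m \<le> n \<Longrightarrow> fst (I s m) \<le> fst (I s n) \<and> snd (I s n) \<le> snd (I s m)" for s m n
  proof (induction n rule: dec_induct)
    case (step n)
    then show ?case using N[OF Ig, of s n n "s n"] unfolding IS by auto
  qed simp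
  have Ile: "fst (I s n) \<le> snd (I s n)" for s n using good_ne[OF Ig[of s n]] by auto
  have Icross: "fst (I s m) \<le> snd (I s n)" for s m n
    using Inest[of m n s] Inest[of n m s] Ile[of s m] Ile[of s n] by (cases "m \<le> n") auto
  have Ilen: "snd (I s (Suc n)) - fst (I s (Suc n)) \<le> (1/2)^n" for s n
    using N[OF Ig, of s n n "s n"] unfolding IS by auto
  define g where "g s = (SUP n. fst (I s n))" for s
  have bdd: "bdd_above (range (\<lambda>n. fst (I s n)))" for s
    using Icross[of s _ 0] by (auto intro!: bdd_aboveI)
  have gI: "fst (I s n) \<le> g s" "g s \<le> snd (I s n)" for s n
    unfolding g_def using Icross by (auto intro: cSUP_upper2 bdd cSUP_least)
  have loc: "open {s. I s n = p}" for n p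
  proof (induction n arbitrary: p)
    case 0
    then show ?case by (cases "p0 = p") (auto simp: I0)
  next
    case (Suc n)
    have "{s. I s (Suc n) = p} = (\<Union>(q, b) \<in> {(q, b). N q n b = p}. {s. I s n = q} \<inter> (\<lambda>s. s n) -` {b})"
      by (auto simp: IS)
    moreover have "open ((\<lambda>s::nat \<Rightarrow> bool. s n) -` {b})" for b
      by (intro open_vimage open_discrete continuous_on_product_coordinates)
    ultimately show ?case using Suc by (auto intro!: open_UN open_Int)
  qed
  have cont: "continuous_on UNIV (\<lambda>s. fst (I s n))" for n
  proof (subst continuous_on_open_vimage[OF open_UNIV], intro allI impI)
    fix B :: "real set"
    have "(\<lambda>s. fst (I s n)) -` B \<inter> UNIV = (\<Union>p \<in> fst -` B. {s. I s n = p})" by auto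
    then show "open ((\<lambda>s. fst (I s n)) -` B \<inter> UNIV)" using loc by (auto intro: open_UN)
  qed
  have small: "\<exists>n. (1/2)^n < e" if "0 < e" for e :: real
    using that real_arch_pow_inv[of e "1/2"] by auto
  have lim: "uniform_limit UNIV (\<lambda>n s. fst (I s (Suc n))) g sequentially"
  proof (rule uniform_limitI)
    fix e :: real assume "0 < e"
    then obtain n0 where n0: "(1/2)^n0 < e" using small by blast
    have "dist (fst (I s (Suc n))) (g s) < e" if "n0 \<le> n" for n s
    proof -
      have "(1/2::real)^n \<le> (1/2)^n0" using that by (simp add: power_decreasing)
      then show ?thesis using gI[where s=s and n="Suc n"] Ilen[of s n] n0
        unfolding dist_real_def by linarith
    qed
    then show "\<forall>\<^sub>F n in sequentially. \<forall>s\<in>UNIV. dist (fst (I s (Suc n))) (g s) < e"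
      unfolding eventually_sequentially by blast
  qed
  have "continuous_on UNIV g"
    by (rule uniform_limit_theorem[OF _ lim]) (simp_all add: cont)
  moreover have "g s \<in> A" for s
  proof -
    have "g s \<in> closure A"
      unfolding closure_approachable
    proof (intro allI impI)
      fix e :: real assume "0 < e"
      then obtain n where n: "(1/2)^n < e" using small by blast
      obtain x where "x \<in> A" "fst (I s (Suc n)) \<le> x" "x \<le> snd (I s (Suc n))"
        using good_ne[OF Ig] by blast
      then show "\<exists>x \<in> A. dist x (g s) < e"
        using gI[where s=s and n="Suc n"] Ilen[of s n] n by (intro bexI[of _ x]) (auto simp: dist_real_def)
    qed
    then show ?thesis using A by simp
  qed
  moreover have "inj (\<lambda>s. f (g s))"
  proof (rule injI, rule ccontr)
    fix s s' assume eq: "f (g s) = f (g s')" and "s \<noteq> s'"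
    then obtain n where n: "s n \<noteq> s' n" "\<And>m. m < n \<Longrightarrow> s m = s' m"
      using exists_least_iff[of "\<lambda>n. s n \<noteq> s' n"] by auto
    have "m \<le> n \<Longrightarrow> I s m = I s' m" for m
      by (induction m) (auto simp: I0 IS n)
    then have II: "I s n = I s' n" by simp
    have lt: "f (g u) < f (g u')" if "\<not> u n" "u' n" "I u n = I u' n" for u u'
    proof -
      have "f (g u) \<le> f (snd (I u (Suc n)))" "f (fst (I u' (Suc n))) \<le> f (g u')"
        using monoD[OF f gI(2)] monoD[OF f gI(1)] by blast+
      then show ?thesis using that Nlt[OF Ig, of u' n n] by (simp add: IS)
    qed
    show False using lt[of s s'] lt[of s' s] n(1) II eq by (cases "s n") auto
  qed
  ultimately show ?thesis using that by blast
qed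

section \<open>The Cantor space and sets of cardinality continuum\<close>

lemma compact_cantor_space: "compact (UNIV :: (nat \<Rightarrow> bool) set)"
proof -
  have "compact_space (product_topology (\<lambda>_. euclidean) UNIV :: (nat \<Rightarrow> bool) topology)"
    unfolding compact_space_product_topology
    by (auto simp: compact_space_def finite_imp_compact)
  then show ?thesis
    by (simp add: euclidean_product_topology compact_space_def)
qed

lemma has_card_continuum_iff_lepoll:
  fixes A :: "real set"
  shows "has_card_continuum A \<longleftrightarrow> (UNIV :: nat set set) \<lesssim> A"
proof -
  have "A \<lesssim> (UNIV :: nat set set)"
    by (meson eqpoll_sym eqpoll_imp_lepoll lepoll_trans nat_sets_eqpoll_reals subset_UNIV subset_imp_lepoll)
  then show ?thesis
    unfolding has_card_continuum_def
    by (metis eqpoll_imp_lepoll eqpoll_sym lepoll_antisym)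
qed

lemma has_card_continuum_uncountable: "has_card_continuum A \<Longrightarrow> uncountable A"
  unfolding has_card_continuum_def
  by (metis Cantors_theorem Pow_UNIV countable_def countable_lepoll countable_subset eqpoll_imp_lepoll
     eqpoll_sym countableI_type lepoll_trans nat_sets_eqpoll_reals uncountable_UNIV_real)

lemma has_card_continuum_diff_countable:
  includes cardinal_syntax
  fixes A :: "real set"
  assumes A: "has_card_continuum A" and B: "countable B"
  shows "has_card_continuum (A - B)"
proof -
  have "uncountable (A - B)"
    using has_card_continuum_uncountable[OF A] B
    by (metis Un_Diff_cancel2 countable_Un countable_subset sup_ge1)
  then have inf: "infinite (A - B)" using countable_finite by blast
  then have "|UNIV :: nat set| \<le>o |A - B|" by (simp add: infinite_iff_card_of_nat)
  moreover have "|A \<inter> B| \<le>o |UNIV :: nat set|"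
    using B unfolding countable_def by (subst card_of_ordLeq[symmetric]) (meson inj_on_Int subset_UNIV inf_commute inj_on_subset inf_le2)
  ultimately have le: "|A \<inter> B| \<le>o |A - B|" using ordLeq_transitive by blast
  then have "|(A - B) \<union> (A \<inter> B)| \<le>o |A - B|"
    by (intro card_of_Un_ordLeq_infinite_Field le)
      (simp_all add: inf Field_card_of card_of_mono1 card_of_card_order_on)
  then have "A \<lesssim> A - B"
    unfolding lepoll_def card_of_ordLeq[symmetric] by (simp add: Int_commute Un_Diff_Int)
  then show ?thesis
    using A unfolding has_card_continuum_iff_lepoll by (rule lepoll_trans[rotated])
qed

text \<open>Splitting bit sequences into even and odd entries cuts the range of \<open>g\<close>
  into continuum many disjoint Cantor sets, one for each even half. \<open>Y\<close> meets each of
  them, and \<open>f\<close> takes different values at the chosen points.\<close>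

lemma bi_bernstein_image_card:
  fixes f :: "real \<Rightarrow> real"
  assumes Y: "bi_bernstein Y" and f: "mono f" and A: "closed A" and big: "uncountable (f ` A)"
  shows "has_card_continuum (f ` (Y \<inter> A))"
proof -
  obtain g :: "(nat \<Rightarrow> bool) \<Rightarrow> real"
    where g: "continuous_on UNIV g" "range g \<subseteq> A" "inj (\<lambda>s. f (g s))"
    using cantor_scheme[OF f A big] by blast
  define w where "w a c n = (if even n then a (n div 2) else c (n div 2))" for a c :: "nat \<Rightarrow> bool" and n
  have w: "w a c = w a' c' \<longleftrightarrow> a = a' \<and> c = c'" for a c a' c'
  proof
    assume eq: "w a c = w a' c'"
    have "a n = a' n" "c n = c' n" for n
      using fun_cong[OF eq, of "2*n"] fun_cong[OF eq, of "2*n+1"] by (auto simp: w_def)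
    then show "a = a' \<and> c = c'" by blast
  qed simp
  have "\<exists>c. g (w a c) \<in> Y" for a
  proof -
    have "continuous_on UNIV (\<lambda>c. w a c)"
    proof (intro continuous_on_coordinatewise_then_product)
      show "continuous_on UNIV (\<lambda>c. w a c n)" for n
        by (cases "even n") (simp_all add: w_def)
    qed
    then have cont: "continuous_on UNIV (\<lambda>c. g (w a c))"
      by (rule continuous_on_compose2[OF g(1)]) auto
    have inj: "inj (\<lambda>c. g (w a c))"
      using g(3) w unfolding inj_def by metis
    have "(UNIV :: (nat \<Rightarrow> bool) set) homeomorphic range (\<lambda>c. g (w a c))"
      using homeomorphism_compact[OF compact_cantor_space cont refl inj] unfolding homeomorphic_def by blast
    then have "cantor_set (range (\<lambda>c. g (w a c)))"
      unfolding cantor_set_def by (rule homeomorphic_sym[THEN iffD1])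
    then show ?thesis using Y unfolding bi_bernstein_def by blast
  qed
  then obtain c where c: "\<And>a. g (w a (c a)) \<in> Y" by metis
  define k where "k S = f (g (w (\<lambda>n. n \<in> S) (c (\<lambda>n. n \<in> S))))" for S :: "nat set"
  have "inj k"
  proof (rule injI)
    fix S S' assume "k S = k S'"
    then have "(\<lambda>n. n \<in> S) = (\<lambda>n. n \<in> S')"
      using injD[OF g(3)] w unfolding k_def by blast
    then show "S = S'" by (auto dest: fun_cong)
  qed
  moreover have "range k \<subseteq> f ` (Y \<inter> A)" using c g(2) unfolding k_def by blast
  ultimately have "(UNIV :: nat set set) \<lesssim> f ` (Y \<inter> A)" unfolding lepoll_def by blast
  then show ?thesis by (simp add: has_card_continuum_iff_lepoll)
qed

lemma bi_bernstein_Int_closed_card: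
  assumes "bi_bernstein Y" "closed A" "uncountable A"
  shows "has_card_continuum (Y \<inter> A)"
  using bi_bernstein_image_card[of Y id A] assms by (simp add: mono_def)

text \<open>A value taken at two points is also taken at a rational between them.\<close>

lemma countable_flat_values:
  fixes f :: "real \<Rightarrow> real"
  assumes "mono f"
  shows "countable {v. \<exists>s t. s < t \<and> f s = v \<and> f t = v}"
proof -
  have "{v. \<exists>s t. s < t \<and> f s = v \<and> f t = v} \<subseteq> f ` \<rat>"
  proof
    fix v assume "v \<in> {v. \<exists>s t. s < t \<and> f s = v \<and> f t = v}"
    then obtain s t where st: "s < t" "f s = v" "f t = v" by blast
    then obtain q where q: "q \<in> \<rat>" "s < q" "q < t" using Rats_dense_in_real by blast
    then have "f q = v" using st monoD[OF assms, of s q] monoD[OF assms, of q t] by simp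
    then show "v \<in> f ` \<rat>" using q by blast
  qed
  then show ?thesis by (rule countable_subset) (simp add: countable_rat)
qed


section \<open>Monotone maps from a lexicographic power to the reals\<close>

lemma power_points_upd:
  "x \<in> power_points X r \<Longrightarrow> i \<in> Field r \<Longrightarrow> c \<in> X \<Longrightarrow> (underS r i \<noteq> {} \<Longrightarrow> -1 \<le> c \<and> c \<le> 1) \<Longrightarrow>
    x(i := c) \<in> power_points X r"
  unfolding power_points_def PiE_def extensional_def by auto

text \<open>The coordinate \<open>i\<close> is the first free one; at the least index the cone is
  the whole power.\<close>

definition cone :: "real set \<Rightarrow> 'i rel \<Rightarrow> 'i \<Rightarrow> ('i \<Rightarrow> real) \<Rightarrow> ('i \<Rightarrow> real) set" where
  "cone X r i x = {z \<in> power_points X r. \<forall>j \<in> underS r i. z j = x j}"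

text \<open>Here \<open>X\<close> stands for \<open>X\<^sub>1\<close> of the overview and
  \<open>X0\<close> for its \<open>X\<close>. The assumptions \<open>two\<close> and
  \<open>one\<close> say over which reals a fibre of \<open>h\<close> has at least two
  points.\<close>

locale power_projection =
  fixes X X0 :: "real set" and r :: "'i rel" and h :: "('i \<Rightarrow> real) \<Rightarrow> real"
  assumes ord: "countable_limit_ordinal r"
    and rat: "\<rat> \<subseteq> X" and rat0: "\<rat> \<subseteq> X0" and unc0: "uncountable X0"
    and h_mono: "\<And>z w. (z, w) \<in> lex_power X r \<Longrightarrow> h z \<le> h w"
    and two: "\<And>t. t \<in> X0 \<Longrightarrow> \<exists>z w. (z, w) \<in> lex_power X r - Id \<and> h z = t \<and> h w = t"
    and one: "\<And>z w. (z, w) \<in> lex_power X r - Id \<Longrightarrow> h z = h w \<Longrightarrow> h z \<in> X0"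
begin

abbreviation "P \<equiv> power_points X r"
abbreviation "K \<equiv> cone X r"

section \<open>The lexicographic order and its cones\<close>

lemma index_wo: "Well_order r" and index_countable: "countable (Field r)" and no_last: "i \<in> Field r \<Longrightarrow> aboveS r i \<noteq> {}"
  using ord unfolding countable_limit_ordinal_def by auto

lemma index_linear: "Linear_order r" using index_wo by (simp add: well_order_on_def)

lemma lex_linear: "Linear_order (lex_power X r)" by (rule linear_order_lex_power[OF index_wo])

lemma lex_antisym: "(z, w) \<in> lex_power X r \<Longrightarrow> (w, z) \<in> lex_power X r \<Longrightarrow> z = w"
  and lex_total: "z \<in> P \<Longrightarrow> w \<in> P \<Longrightarrow> (z, w) \<in> lex_power X r \<or> (w, z) \<in> lex_power X r"
  using linear_order_facts[OF lex_linear] unfolding Field_lex_power by metis+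

lemma under_cases: "i \<in> Field r \<Longrightarrow> j \<in> Field r \<Longrightarrow> j \<in> underS r i \<or> j = i \<or> i \<in> underS r j"
  using linear_order_facts(4)[OF index_linear] unfolding underS_def by blast

lemma under_trans: "k \<in> underS r j \<Longrightarrow> j \<in> underS r i \<Longrightarrow> k \<in> underS r i"
  using linear_order_facts(2,3)[OF index_linear] unfolding underS_def by blast

lemma under_irrefl: "i \<notin> underS r i" by (simp add: underS_def)

lemma under_Field: "j \<in> underS r i \<Longrightarrow> j \<in> Field r"
  by (auto simp: underS_def Field_def)

lemma above_Field: "k \<in> aboveS r i \<Longrightarrow> k \<in> Field r \<and> i \<in> underS r k"
  by (auto simp: aboveS_def underS_def Field_def)

lemma under_induct: "(\<And>i. (\<And>j. j \<in> underS r i \<Longrightarrow> Q j) \<Longrightarrow> Q i) \<Longrightarrow> Q i"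
  using wo_rel.well_order_induct[of r Q i] index_wo unfolding wo_rel_def underS_def by blast

lemma lex_points: "(z, w) \<in> lex_power X r \<Longrightarrow> z \<in> P \<and> w \<in> P"
  unfolding lex_power_def by blast

lemma lexI: "z \<in> P \<Longrightarrow> w \<in> P \<Longrightarrow> i \<in> Field r \<Longrightarrow> (\<And>j. j \<in> underS r i \<Longrightarrow> z j = w j) \<Longrightarrow> z i < w i \<Longrightarrow>
    (z, w) \<in> lex_power X r"
  unfolding lex_power_def by blast

lemma lex_cases:
  assumes "(z, w) \<in> lex_power X r"
  obtains "z = w" | i where "i \<in> Field r" "\<And>j. j \<in> underS r i \<Longrightarrow> z j = w j" "z i < w i"
  using assms unfolding lex_power_def by blast

lemma h_less: "z \<in> P \<Longrightarrow> w \<in> P \<Longrightarrow> h z < h w \<Longrightarrow> (z, w) \<in> lex_power X r"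
  using lex_total h_mono by (metis not_le)

lemma cone_P: "z \<in> K i x \<Longrightarrow> z \<in> P"
  by (simp add: cone_def)

text \<open>If \<open>u\<close> left the prefix of \<open>z\<close> below \<open>i\<close>, then,
  being above \<open>z\<close>, it would also exceed \<open>w\<close>, which has the same
  prefix.\<close>

lemma cone_convex:
  assumes z: "z \<in> K i x" and w: "w \<in> K i x" and zu: "(z, u) \<in> lex_power X r" and uw: "(u, w) \<in> lex_power X r"
    and i: "i \<in> Field r"
  shows "u \<in> K i x"
  using zu
proof (cases rule: lex_cases)
  case 1
  then show ?thesis using z by simp
next
  case zu: (2 k)
  show ?thesis
  proof (cases "k \<in> underS r i")
    case False
    then have "underS r i \<subseteq> underS r k"
      using under_cases[OF i zu(1)] under_trans by blast
    then show ?thesis using z zu(2) lex_points[OF uw] unfolding cone_def by force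
  next
    case k: True
    have zw: "z j = w j" if "j \<in> underS r i" for j
      using z w that unfolding cone_def by simp
    have "(w, u) \<in> lex_power X r"
      using zu zw k under_trans cone_P[OF w] lex_points[OF uw] by (intro lexI[of _ _ k]) force+
    then have "w = u" using uw lex_antisym by blast
    then show ?thesis using w by simp
  qed
qed

text \<open>This is how cones are detected through \<open>h\<close>: the whole fibre over a real
  strictly inside the image of a cone lies in that cone.\<close>

lemma cone_between:
  assumes "z \<in> K i x" "w \<in> K i x" "h z < h u" "h u < h w" "u \<in> P" "i \<in> Field r"
  shows "u \<in> K i x"
  using assms h_less cone_P cone_convex[of z i x w u] by blast

lemma coord_mono:
  assumes "z \<in> K i x" "w \<in> K i x" "(z, w) \<in> lex_power X r" "i \<in> Field r"
  shows "z i \<le> w i"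
  using assms(3)
proof (cases rule: lex_cases)
  case (2 k)
  have "z k = w k" if "k \<in> underS r i" using assms(1,2) that unfolding cone_def by simp
  then show ?thesis using under_cases[OF assms(4) 2(1)] 2 by force
qed simp

section \<open>Images of cones under \<open>h\<close>\<close>

lemma surj: "t \<in> X0 \<Longrightarrow> \<exists>z \<in> P. h z = t"
  using two lex_points by (metis DiffD1)

lemma cofinal: "\<exists>z \<in> P. h z < t" "\<exists>z \<in> P. t < h z"
proof -
  obtain p q :: real where "p \<in> \<rat>" "p < t" "q \<in> \<rat>" "t < q"
    using Rats_dense_in_real[of "t - 1" t] Rats_dense_in_real[of t "t + 1"] by auto
  then show "\<exists>z \<in> P. h z < t" "\<exists>z \<in> P. t < h z"
    using surj rat0 by (metis subsetD)+
qed

text \<open>For nonempty \<open>S\<close> this is the open interval from the infimum to the supremum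
  of \<open>h\<close> on \<open>S\<close>, possibly unbounded.\<close>

definition extent :: "('i \<Rightarrow> real) set \<Rightarrow> real set" where
  "extent S = {t. \<exists>z \<in> S. \<exists>w \<in> S. h z < t \<and> t < h w}"

lemma extentI: "z \<in> S \<Longrightarrow> w \<in> S \<Longrightarrow> h z < t \<Longrightarrow> t < h w \<Longrightarrow> t \<in> extent S"
  unfolding extent_def by blast

lemma extent_convex: "s \<in> extent S \<Longrightarrow> u \<in> extent S \<Longrightarrow> s \<le> t \<Longrightarrow> t \<le> u \<Longrightarrow> t \<in> extent S"
  unfolding extent_def by (auto intro: le_less_trans less_le_trans)

lemma open_extent: "open (extent S)"
proof -
  have "extent S = (\<Union>z \<in> S. \<Union>w \<in> S. {h z<..<h w})" unfolding extent_def by auto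
  then show ?thesis by (auto intro!: open_UN)
qed

lemma extent_root: "underS r i = {} \<Longrightarrow> extent (K i x) = UNIV"
  using cofinal unfolding extent_def cone_def by auto

text \<open>At the first index below \<open>i\<close> where \<open>x\<close> and \<open>y\<close>
  differ, the smaller coordinate puts its cone entirely below the other, so the extents cannot
  meet.\<close>

lemma extent_disjoint:
  assumes i: "i \<in> Field r" and "t \<in> extent (K i x)" "t \<in> extent (K i y)" "x \<in> P" "y \<in> P"
    and k: "k \<in> underS r i"
  shows "x k = y k"
proof -
  have *: "x' j \<ge> y' j"
    if t: "t \<in> extent (K i x')" "t \<in> extent (K i y')" and j: "j \<in> underS r i" "\<And>k. k \<in> underS r j \<Longrightarrow> x' k = y' k"
    for x' y' j
  proof (rule ccontr)
    assume lt: "\<not> x' j \<ge> y' j"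
    obtain z where z: "z \<in> K i x'" "t < h z" using t(1) unfolding extent_def by blast
    obtain w where w: "w \<in> K i y'" "h w < t" using t(2) unfolding extent_def by blast
    have "(z, w) \<in> lex_power X r"
      using z w j lt under_trans under_Field unfolding cone_def by (intro lexI[of _ _ j]) force+
    then show False using h_mono z(2) w(2) by force
  qed
  have "k \<in> underS r i \<longrightarrow> x k = y k" for k
  proof (induction k rule: under_induct)
    case (1 k)
    show ?case
    proof
      assume k: "k \<in> underS r i"
      have "x m = y m" if "m \<in> underS r k" for m
        using 1 that under_trans[OF that k] by blast
      then show "x k = y k" using *[of x y k] *[of y x k] assms k by force
    qed
  qed
  then show ?thesis using k by blast
qed

lemma cone_cong: "(\<And>j. j \<in> underS r i \<Longrightarrow> x j = y j) \<Longrightarrow> K i x = K i y"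
  unfolding cone_def by auto

text \<open>A cone is wide when \<open>h\<close> is not constant on it.\<close>

definition wide_cones :: "'i \<Rightarrow> ('i \<Rightarrow> real) set set" where
  "wide_cones i = {K i x | x. x \<in> P \<and> extent (K i x) \<noteq> {}}"

definition wide_region :: "'i \<Rightarrow> real set" where
  "wide_region i = \<Union>(extent ` wide_cones i)"

lemma in_wide_region: "t \<in> wide_region i \<longleftrightarrow> (\<exists>x \<in> P. t \<in> extent (K i x))"
  unfolding wide_region_def wide_cones_def by blast

lemma closed_compl_wide_region: "closed (- wide_region i)"
  unfolding wide_region_def by (intro closed_Compl open_UN ballI open_extent)

text \<open>Extents of different cones of one level are disjoint, and each nonempty one contains a
  rational.\<close>

lemma countable_wide_cones:
  assumes i: "i \<in> Field r"
  shows "countable (wide_cones i)"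
proof -
  have "\<exists>q \<in> \<rat>. q \<in> extent S" if S: "S \<in> wide_cones i" for S
  proof -
    obtain t z w where "z \<in> S" "w \<in> S" "h z < t" "t < h w"
      using S unfolding wide_cones_def extent_def by auto
    moreover obtain q where "q \<in> \<rat>" "h z < q" "q < t" using Rats_dense_in_real[OF \<open>h z < t\<close>] by blast
    ultimately show ?thesis using extentI[of z S w q] by auto
  qed
  then obtain q where q: "\<And>S. S \<in> wide_cones i \<Longrightarrow> q S \<in> \<rat> \<and> q S \<in> extent S" by metis
  have "inj_on q (wide_cones i)"
  proof (rule inj_onI)
    fix S S' assume S: "S \<in> wide_cones i" "S' \<in> wide_cones i" "q S = q S'"
    then obtain x y where "S = K i x" "x \<in> P" "S' = K i y" "y \<in> P" unfolding wide_cones_def by blast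
    then show "S = S'" using q[OF S(1)] q[OF S(2)] S(3) extent_disjoint[OF i, of "q S" x y] cone_cong by metis
  qed
  moreover have "q ` wide_cones i \<subseteq> \<rat>" using q by blast
  ultimately show ?thesis by (meson countable_image_inj_on countable_rat countable_subset)
qed

text \<open>These are the finite endpoints of the interval \<open>extent S\<close>, described
  without suprema so that unbounded and empty extents are covered as well.\<close>

definition ends :: "('i \<Rightarrow> real) set \<Rightarrow> real set" where
  "ends S = {t. t \<notin> extent S \<and> ((\<exists>s>t. {t<..<s} \<subseteq> extent S) \<or> (\<exists>s<t. {s<..<t} \<subseteq> extent S))}"

text \<open>By convexity there is at most one left end and at most one right end.\<close>

lemma countable_ends: "countable (ends S)"
proof -
  have sub: "countable A" if "\<And>a b. a \<in> A \<Longrightarrow> b \<in> A \<Longrightarrow> a < b \<Longrightarrow> False" for A :: "real set"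
  proof -
    have "A \<subseteq> {SOME a. a \<in> A}" using that by (metis linorder_neqE singletonI some_in_eq subsetI empty_iff)
    then show ?thesis by (rule countable_subset) simp
  qed
  have "countable {t. t \<notin> extent S \<and> (\<exists>s>t. {t<..<s} \<subseteq> extent S)}"
  proof (rule sub)
    fix a b assume "a \<in> {t. t \<notin> extent S \<and> (\<exists>s>t. {t<..<s} \<subseteq> extent S)}"
      "b \<in> {t. t \<notin> extent S \<and> (\<exists>s>t. {t<..<s} \<subseteq> extent S)}" and ab: "a < b"
    then obtain s u where s: "a < s" "{a<..<s} \<subseteq> extent S" "b \<notin> extent S" "b < u" "{b<..<u} \<subseteq> extent S"
      by blast
    obtain c where c: "a < c" "c < min s b" using dense[of a "min s b"] s ab by auto
    obtain d where d: "b < d" "d < u" using dense s by blast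
    have "c \<in> extent S" "d \<in> extent S" using c d s by auto
    then show False using extent_convex[of c S d b] c d s by auto
  qed
  moreover have "countable {t. t \<notin> extent S \<and> (\<exists>s<t. {s<..<t} \<subseteq> extent S)}"
  proof (rule sub)
    fix a b assume "a \<in> {t. t \<notin> extent S \<and> (\<exists>s<t. {s<..<t} \<subseteq> extent S)}"
      "b \<in> {t. t \<notin> extent S \<and> (\<exists>s<t. {s<..<t} \<subseteq> extent S)}" and ab: "a < b"
    then obtain s u where s: "s < b" "{s<..<b} \<subseteq> extent S" "a \<notin> extent S" "u < a" "{u<..<a} \<subseteq> extent S"
      by blast
    obtain c where c: "max s a < c" "c < b" using dense[of "max s a" b] s ab by auto
    obtain d where d: "u < d" "d < a" using dense s by blast
    have "c \<in> extent S" "d \<in> extent S" using c d s by auto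
    then show False using extent_convex[of d S c a] c d s by auto
  qed
  ultimately show ?thesis
    unfolding ends_def by (rule countable_subset[OF _ countable_Un, rotated]) auto
qed

text \<open>
  The cut-off \<open>-n\<close> keeps the supremum monotone in \<open>t\<close> where no point of \<open>S\<close> qualifies.
\<close>

definition level :: "'i \<Rightarrow> ('i \<Rightarrow> real) set \<Rightarrow> nat \<Rightarrow> real \<Rightarrow> real" where
  "level i S n t = Sup (insert (- real n) {z i | z. z \<in> S \<and> h z \<le> t})"

text \<open>At the least index the coordinates are not confined to [-1, 1]; there a point mapped
  beyond \<open>t\<close> supplies the bound.\<close>

lemma level_bdd:
  assumes i: "i \<in> Field r"
  shows "bdd_above (insert (- real n) {z i | z. z \<in> K i x \<and> h z \<le> t})"
proof (cases "underS r i = {}")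
  case True
  obtain w where w: "w \<in> P" "t < h w" using cofinal by blast
  have "z i \<le> w i" if "z \<in> K i x" "h z \<le> t" for z
  proof (rule coord_mono[OF that(1) _ _ i])
    show "w \<in> K i x" using True w unfolding cone_def by simp
    show "(z, w) \<in> lex_power X r" using that w cone_P by (intro h_less) auto
  qed
  then have "bdd_above {z i | z. z \<in> K i x \<and> h z \<le> t}" by (auto intro: bdd_aboveI[of _ "w i"])
  then show ?thesis by simp
next
  case False
  have "z i \<le> 1" if "z \<in> K i x" for z
    using that False i unfolding cone_def power_points_def by blast
  then have "bdd_above {z i | z. z \<in> K i x \<and> h z \<le> t}" by (auto intro: bdd_aboveI[of _ 1])
  then show ?thesis by simp
qed

lemma level_ge:
  assumes "i \<in> Field r" "z \<in> K i x" "h z \<le> t"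
  shows "z i \<le> level i (K i x) n t"
  unfolding level_def using assms by (intro cSup_upper level_bdd) auto

lemma level_le:
  assumes "\<And>z. z \<in> S \<Longrightarrow> h z \<le> t \<Longrightarrow> z i \<le> u" "- real n \<le> u"
  shows "level i S n t \<le> u"
  unfolding level_def using assms by (intro cSup_least) auto

lemma level_min: "i \<in> Field r \<Longrightarrow> - real n \<le> level i (K i x) n t"
  unfolding level_def by (intro cSup_upper level_bdd) auto

lemma mono_level: "i \<in> Field r \<Longrightarrow> mono (level i (K i x) n)"
  by (intro monoI level_le level_ge level_min) auto

lemma upd_0_1: "x \<in> P \<Longrightarrow> i \<in> Field r \<Longrightarrow> x(i := 0) \<in> P \<and> x(i := 1) \<in> P"
  using rat by (auto intro!: power_points_upd)

lemma not_const:
  assumes x: "x \<in> P" and i: "i \<in> Field r" and h: "h (x(i := 0)) = y" "h (x(i := 1)) = y"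
  shows "y \<in> X0"
proof -
  have "(x(i := 0), x(i := 1)) \<in> lex_power X r"
    using upd_0_1[OF x i] i under_irrefl by (intro lexI[of _ _ i]) auto
  moreover have "x(i := 0) \<noteq> x(i := 1)" by (metis fun_upd_same zero_neq_one)
  ultimately show ?thesis using one[of "x(i := 0)" "x(i := 1)"] h by auto
qed

text \<open>If \<open>y\<close> were the only argument with value \<open>v\<close>, then
  \<open>h\<close> would equal \<open>y\<close> at every point of the cone with \<open>i\<close>-th
  coordinate \<open>v\<close>. Two such points can be made to differ at a later index, which puts
  \<open>y\<close> into \<open>X0\<close>.\<close>

lemma level_value_flat:
  assumes y: "y \<notin> X0" and x: "x \<in> P" and i: "i \<in> Field r"
    and v: "level i (K i x) n y = v" "v \<in> X" "v \<noteq> - real n"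
  shows "\<exists>t. t \<noteq> y \<and> level i (K i x) n t = v"
proof (rule ccontr)
  assume "\<not> ?thesis"
  then have uniq: "\<And>t. level i (K i x) n t = v \<Longrightarrow> t = y" by blast
  have vn: "- real n < v" using level_min[OF i, of n x y] v by simp
  \<comment> \<open>A point with \<open>h w < y\<close> would raise the level to \<open>v\<close>
    already at \<open>h w\<close>; a point with \<open>y < h w\<close> would hold it at
    \<open>v\<close> beyond \<open>y\<close>.\<close>
  have const: "h w = y" if w: "w \<in> K i x" "w i = v" for w
  proof (rule ccontr)
    assume "h w \<noteq> y"
    then consider "h w < y" | "y < h w" by linarith
    then show False
    proof cases
      case 1
      have "v \<le> level i (K i x) n (h w)" using level_ge[OF i w(1)] w(2) by simp
      moreover have "level i (K i x) n (h w) \<le> v" using monoD[OF mono_level[OF i], of "h w" y x n] v 1 by simp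
      ultimately show False using uniq[of "h w"] 1 by simp
    next
      case 2
      then obtain t where t: "y < t" "t < h w" using dense by blast
      have "level i (K i x) n t \<le> v"
      proof (rule level_le)
        fix z assume z: "z \<in> K i x" "h z \<le> t"
        have "(z, w) \<in> lex_power X r" using z w t cone_P by (intro h_less) auto
        then show "z i \<le> v" using coord_mono[OF z(1) w(1) _ i] w(2) by simp
      qed (use vn in simp)
      moreover have "v \<le> level i (K i x) n t" using monoD[OF mono_level[OF i], of y t x n] v t by simp
      ultimately show False using uniq[of t] t by simp
    qed
  qed
  \<comment> \<open>To serve as a coordinate, \<open>v\<close> must respect the bounds. Since
    \<open>v\<close> is not the default \<open>- real n\<close>, some point of the cone qualifies in
    the supremum.\<close>
  have bnd: "-1 \<le> v \<and> v \<le> 1" if u: "underS r i \<noteq> {}"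
  proof -
    have b: "-1 \<le> z i \<and> z i \<le> 1" if "z \<in> K i x" for z
      using that u i unfolding cone_def power_points_def by blast
    have "v \<le> 1" unfolding v(1)[symmetric] by (rule level_le) (use b in auto)
    moreover have "\<exists>z. z \<in> K i x \<and> h z \<le> y"
    proof (rule ccontr)
      assume "\<not> ?thesis"
      then have "level i (K i x) n y \<le> - real n" by (intro level_le) auto
      then show False using v vn by simp
    qed
    then obtain z where "z \<in> K i x" "h z \<le> y" by blast
    then have "-1 \<le> v" using b level_ge[OF i, of z x y n] v(1) by fastforce
    ultimately show ?thesis by simp
  qed
  define z where "z = x(i := v)"
  have z: "z \<in> P" unfolding z_def using x i v bnd by (intro power_points_upd) auto
  \<comment> \<open>The limit ordinal has an index \<open>k\<close> after \<open>i\<close>; changing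
    coordinate \<open>k\<close> stays in the cone and keeps coordinate \<open>i\<close>.\<close>
  obtain k where k: "k \<in> Field r" "i \<in> underS r k" using no_last[OF i] above_Field by blast
  have "z(k := c) \<in> K i x \<and> (z(k := c)) i = v" if "c \<in> {0, 1}" for c
  proof -
    have "z(k := c) \<in> P" using upd_0_1[OF z k(1)] that by auto
    moreover have "k \<notin> underS r i" "k \<noteq> i" using k under_trans under_irrefl by metis+
    ultimately show ?thesis using under_irrefl[of i] unfolding cone_def z_def by auto
  qed
  then show False using not_const[OF z k(1)] const y by blast
qed

lemma countable_level_image:
  assumes i: "i \<in> Field r" and x: "x \<in> P" and Y: "Y \<inter> X0 = {}"
  shows "countable (level i (K i x) n ` Y \<inter> X)"
proof (rule countable_subset)
  let ?f = "level i (K i x) n"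
  show "?f ` Y \<inter> X \<subseteq> insert (- real n) {v. \<exists>s t. s < t \<and> ?f s = v \<and> ?f t = v}"
  proof
    fix v assume v: "v \<in> ?f ` Y \<inter> X"
    then obtain y where y: "y \<in> Y" "?f y = v" by blast
    show "v \<in> insert (- real n) {v. \<exists>s t. s < t \<and> ?f s = v \<and> ?f t = v}"
    proof (cases "v = - real n")
      case False
      then obtain t where "t \<noteq> y" "?f t = v"
        using level_value_flat[OF _ x i y(2)] v y Y by blast
      then have "t < y \<or> y < t" by linarith
      then show ?thesis using y(2) \<open>?f t = v\<close> by blast
    qed simp
  qed
  show "countable (insert (- real n) {v. \<exists>s t. s < t \<and> ?f s = v \<and> ?f t = v})"
    using countable_flat_values[OF mono_level[OF i]] by simp
qed

text \<open>
  If every level function has countable range, then at a successor level two points of the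
  remainder with the same value would lie in one cone of that level, up to an end of its extent.
\<close>

lemma successor_remainder_countable:
  assumes i: "i \<in> Field r" and k: "k \<in> underS r i" "underS r i \<subseteq> insert k (underS r k)"
    and ct: "\<And>x n. x \<in> P \<Longrightarrow> countable (range (level k (K k x) n))"
  shows "countable (wide_region k - wide_region i - (\<Union>S \<in> wide_cones i. ends S))"
proof -
  let ?B = "wide_region k - wide_region i - (\<Union>S \<in> wide_cones i. ends S)"
  \<comment> \<open>A level above \<open>- real n\<close> is not the default value; each point of an
    extent satisfies this for some \<open>n\<close>.\<close>
  define G where "G S n = {y \<in> ?B \<inter> extent S. - real n < level k S n y}" for S n
  have kF: "k \<in> Field r" using k under_Field by blast
  have inj: "level k S n y1 \<noteq> level k S n y2"
    if S: "S = K k x" "x \<in> P" and y: "y1 \<in> G S n" "y2 \<in> G S n" "y1 < y2" for S x n y1 y2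
  proof
    assume eq: "level k S n y1 = level k S n y2"
    define v where "v = level k S n y1"
    have vn: "- real n < v" using y unfolding G_def v_def by simp
    \<comment> \<open>A point over a rational between \<open>y1\<close> and \<open>y2\<close> has
      its \<open>k\<close>-th coordinate squeezed between the two equal levels.\<close>
    have pts: "\<exists>w \<in> S. h w = t \<and> w k = v" if t: "t \<in> \<rat>" "y1 < t" "t < y2" for t
    proof -
      obtain w where w: "w \<in> P" "h w = t" using surj t rat0 by blast
      have "t \<in> extent S" using extent_convex[of y1 S y2 t] y t unfolding G_def by simp
      then have wS: "w \<in> S" using cone_between[of _ k x _ w] w kF unfolding extent_def S by blast
      have "w k \<le> level k S n y2" using level_ge[OF kF, of w x y2 n] wS w t unfolding S by simp
      moreover have "level k S n y1 \<le> w k"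
      proof (rule level_le)
        have mon: "z k \<le> w k" if z: "z \<in> S" "h z \<le> y1" for z
        proof -
          have "(z, w) \<in> lex_power X r" using z w t cone_P unfolding S by (intro h_less) auto
          then show ?thesis using coord_mono[of z k x w] z wS kF unfolding S by blast
        qed
        show "z k \<le> w k" if "z \<in> S" "h z \<le> y1" for z using mon that .
        show "- real n \<le> w k"
        proof (rule ccontr)
          assume "\<not> - real n \<le> w k"
          then have "level k S n y1 \<le> - real n" using mon by (intro level_le) force+
          then show False using vn unfolding v_def by simp
        qed
      qed
      ultimately show ?thesis using w wS eq unfolding v_def by auto
    qed
    obtain t0 where "t0 \<in> \<rat>" "y1 < t0" "t0 < y2" using Rats_dense_in_real y(3) by blast
    then obtain w0 where w0: "w0 \<in> S" "h w0 = t0" "w0 k = v" using pts by blast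
    \<comment> \<open>Since \<open>k\<close> is the immediate predecessor of \<open>i\<close>,
      agreement below \<open>k\<close> and at \<open>k\<close> is agreement below
      \<open>i\<close>.\<close>
    have same: "w \<in> K i w0" if "w \<in> S" "w k = v" for w
      using that w0 k(2) unfolding S cone_def by auto
    have sub: "{y1<..<y2} \<subseteq> extent (K i w0)"
    proof
      fix s assume s: "s \<in> {y1<..<y2}"
      obtain a where a: "a \<in> \<rat>" "y1 < a" "a < s" using Rats_dense_in_real[of y1 s] s by auto
      obtain b where b: "b \<in> \<rat>" "s < b" "b < y2" using Rats_dense_in_real[of s y2] s by auto
      obtain wa where "wa \<in> S" "h wa = a" "wa k = v" using pts[of a] a b by auto
      moreover obtain wb where "wb \<in> S" "h wb = b" "wb k = v" using pts[of b] a b by auto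
      ultimately show "s \<in> extent (K i w0)" using a b same by (intro extentI[of wa _ wb]) auto
    qed
    have w0P: "w0 \<in> P" using w0 cone_P S by blast
    have wide: "K i w0 \<in> wide_cones i"
      using w0P sub dense[OF y(3)] unfolding wide_cones_def by fastforce
    have "y1 \<notin> extent (K i w0)" using y(1) w0P in_wide_region unfolding G_def by blast
    then have "y1 \<in> ends (K i w0)" using sub y(3) unfolding ends_def by blast
    then show False using y(1) wide unfolding G_def by blast
  qed
  have "countable (G S n)" if SkT: "S \<in> wide_cones k" for S n
  proof -
    obtain x where S: "S = K k x" "x \<in> P" using SkT unfolding wide_cones_def by blast
    have "inj_on (level k S n) (G S n)"
      using inj[OF S, of _ n] by (metis inj_onI linorder_neqE)
    moreover have "countable (level k S n ` G S n)"
      using ct[OF S(2), of n] unfolding S by (rule countable_subset[rotated]) auto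
    ultimately show ?thesis using countable_image_inj_on by blast
  qed
  then have "countable (\<Union>S \<in> wide_cones k. \<Union>n. G S n)"
    using countable_wide_cones[OF kF] by auto
  moreover have "?B \<subseteq> (\<Union>S \<in> wide_cones k. \<Union>n. G S n)"
  proof
    fix y assume y: "y \<in> ?B"
    then obtain S where S: "S \<in> wide_cones k" "y \<in> extent S" unfolding wide_region_def by blast
    then obtain x where x: "S = K k x" unfolding wide_cones_def by blast
    obtain z where z: "z \<in> S" "h z < y" using S unfolding extent_def by blast
    obtain n where n: "- z k < real n" using reals_Archimedean2 by blast
    have "z k \<le> level k S n y" using level_ge[OF kF, of z x y n] z x by simp
    then have "y \<in> G S n" using y S n unfolding G_def by simp
    then show "y \<in> (\<Union>S \<in> wide_cones k. \<Union>n. G S n)" using S by blast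
  qed
  ultimately show ?thesis by (rule countable_subset[rotated])
qed

text \<open>
  At a limit level the cones around \<open>y\<close> shrink to a single cone, on which \<open>h\<close> cannot be
  constantly \<open>y\<close>; hence its extent reaches \<open>y\<close> from one side.
\<close>

lemma limit_remainder:
  assumes i: "i \<in> Field r" and lim: "\<And>k. k \<in> underS r i \<Longrightarrow> \<exists>l \<in> underS r i. k \<in> underS r l"
    and y: "y \<notin> X0" "\<And>k. k \<in> underS r i \<Longrightarrow> y \<in> wide_region k"
  shows "y \<in> wide_region i \<union> (\<Union>S \<in> wide_cones i. ends S)"
proof -
  obtain x where x: "\<And>k. k \<in> underS r i \<Longrightarrow> x k \<in> P \<and> y \<in> extent (K k (x k))"
    using y(2) unfolding in_wide_region by metis
  have sub: "extent (K l u) \<subseteq> extent (K k u)" if "k \<in> underS r l" for k l u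
    using that under_trans unfolding extent_def cone_def by blast
  have comp: "x k j = x l j" if kl: "k \<in> underS r i" "l \<in> underS r i" "j \<in> underS r k" "j \<in> underS r l" for k l j
  proof -
    have *: "x k j = x l j" if "k \<in> underS r i" "l \<in> underS r i" "j \<in> underS r k" "k = l \<or> k \<in> underS r l" for k l
      using extent_disjoint[of k y "x k" "x l" j] sub[of k l "x l"] x that under_Field by blast
    show ?thesis using *[of k l] *[of l k] under_cases[of k l] kl under_Field by metis
  qed
  obtain l where l: "\<And>j. j \<in> underS r i \<Longrightarrow> l j \<in> underS r i \<and> j \<in> underS r (l j)"
    using lim by metis
  \<comment> \<open>Below \<open>i\<close> the point \<open>z\<close> follows the cones around
    \<open>y\<close>: coordinate \<open>j\<close> is read off at a later level \<open>l j\<close>,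
    whose cone already fixes it. The remaining coordinates get the admissible value 0.\<close>
  define z where "z j = (if j \<in> underS r i then x (l j) j else if j \<in> Field r then 0 else undefined)" for j
  have zP: "z \<in> P"
  proof -
    have "x (l j) \<in> P" if "j \<in> underS r i" for j using x l that by blast
    then show ?thesis
      using under_Field rat Rats_0
      unfolding power_points_def PiE_def Pi_def extensional_def z_def by auto
  qed
  have cone_z: "w \<in> K i z \<longleftrightarrow> w \<in> P \<and> (\<forall>k \<in> underS r i. w \<in> K k (x k))" for w
  proof
    assume w: "w \<in> K i z"
    have "w j = x k j" if k: "k \<in> underS r i" "j \<in> underS r k" for k j
    proof -
      have j: "j \<in> underS r i" using under_trans k by blast
      then have "w j = x (l j) j" using w unfolding cone_def z_def by simp
      then show ?thesis using comp[of "l j" k j] l[OF j] k by simp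
    qed
    then show "w \<in> P \<and> (\<forall>k \<in> underS r i. w \<in> K k (x k))" using w unfolding cone_def by blast
  next
    assume w: "w \<in> P \<and> (\<forall>k \<in> underS r i. w \<in> K k (x k))"
    have "w j = z j" if "j \<in> underS r i" for j
      using w l[OF that] that unfolding cone_def z_def by auto
    then show "w \<in> K i z" using w unfolding cone_def by blast
  qed
  have fin: "y \<in> wide_region i \<union> (\<Union>S \<in> wide_cones i. ends S)"
    if a: "{a<..<b} \<subseteq> extent (K i z)" "a < b" "y = a \<or> y = b" for a b
  proof -
    have "K i z \<in> wide_cones i" using zP a(1) dense[OF a(2)] unfolding wide_cones_def by fastforce
    moreover have "y \<in> extent (K i z) \<or> y \<in> ends (K i z)" using a unfolding ends_def by blast
    ultimately show ?thesis unfolding wide_region_def by blast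
  qed
  have "z(i := c) \<in> K i z" if "c \<in> {0, 1}" for c
    using upd_0_1[OF zP i] under_irrefl[of i] that unfolding cone_def by auto
  then obtain w where w: "w \<in> K i z" "h w \<noteq> y"
    using not_const[OF zP i] y(1) by blast
  \<comment> \<open>Such a \<open>t\<close> is strictly inside the image of every lower cone around
    \<open>y\<close>: \<open>w\<close> bounds it on one side, a point of the cone beyond
    \<open>y\<close> on the other. So its fibre lies in all these cones.\<close>
  have pt: "\<exists>u \<in> K i z. h u = t" if t: "t \<in> \<rat>" "h w < t \<and> t < y \<or> y < t \<and> t < h w" for t
  proof -
    obtain u where u: "u \<in> P" "h u = t" using surj t rat0 by blast
    have "u \<in> K k (x k)" if k: "k \<in> underS r i" for k
    proof -
      obtain a b where "a \<in> K k (x k)" "b \<in> K k (x k)" "h a < y" "y < h b"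
        using x[OF k] unfolding extent_def by auto
      moreover have "w \<in> K k (x k)" using w cone_z k by blast
      moreover have "k \<in> Field r" using k under_Field by blast
      ultimately show ?thesis
        using cone_between[of w k "x k" b u] cone_between[of a k "x k" w u] u t(2) by auto
    qed
    then show ?thesis using u cone_z by blast
  qed
  consider "h w < y" | "y < h w" using w by linarith
  then show ?thesis
  proof cases
    case 1
    have "{h w<..<y} \<subseteq> extent (K i z)"
    proof
      fix s assume s: "s \<in> {h w<..<y}"
      obtain t where "t \<in> \<rat>" "s < t" "t < y" using Rats_dense_in_real[of s y] s by auto
      then obtain u where "u \<in> K i z" "h u = t" using pt[of t] s by auto
      then show "s \<in> extent (K i z)" using w(1) s \<open>s < t\<close> by (intro extentI[of w _ u]) auto
    qed
    then show ?thesis using fin 1 by blast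
  next
    case 2
    have "{y<..<h w} \<subseteq> extent (K i z)"
    proof
      fix s assume s: "s \<in> {y<..<h w}"
      obtain t where "t \<in> \<rat>" "y < t" "t < s" using Rats_dense_in_real[of y s] s by auto
      then obtain u where "u \<in> K i z" "h u = t" using pt[of t] s by auto
      then show "s \<in> extent (K i z)" using w(1) s \<open>t < s\<close> by (intro extentI[of u _ w]) auto
    qed
    then show ?thesis using fin 2 by blast
  qed
qed

text \<open>The complement of a wide region is closed, so if uncountable it contains uncountably
  many points of \<open>Y\<close>. Only countably many of them are missed at a lower level or are
  ends of extents; the successor and limit cases show that the rest is countable too.\<close>

lemma cocountable_wide_region:
  assumes ct: "\<And>i x n. i \<in> Field r \<Longrightarrow> x \<in> P \<Longrightarrow> countable (range (level i (K i x) n))"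
    and Y: "bi_bernstein Y" "Y \<inter> X0 = {}" and i: "i \<in> Field r"
  shows "countable (- wide_region i)"
  using i
proof (induction i rule: under_induct)
  case (1 i)
  note i = 1(2)
  define E where "E = (\<Union>S \<in> wide_cones i. ends S)"
  define B where "B = Y \<inter> - wide_region i - (\<Union>k \<in> underS r i. - wide_region k) - E"
  show ?case
  proof (rule ccontr)
    assume "uncountable (- wide_region i)"
    then have "uncountable (Y \<inter> - wide_region i)"
      using bi_bernstein_Int_closed_card[OF Y(1) closed_compl_wide_region] has_card_continuum_uncountable by blast
    moreover have "countable (underS r i)"
      by (rule countable_subset[OF _ index_countable]) (auto dest: under_Field)
    then have "countable (\<Union>k \<in> underS r i. - wide_region k)" using 1(1) under_Field by blast
    moreover have "countable E" unfolding E_def using countable_wide_cones[OF i] countable_ends by blast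
    ultimately have "uncountable B" unfolding B_def by (simp add: uncountable_minus_countable)
    moreover have "countable B"
    proof -
      consider "underS r i = {}"
        | k where "k \<in> underS r i" "underS r i \<subseteq> insert k (underS r k)"
        | "\<And>k. k \<in> underS r i \<Longrightarrow> \<exists>l \<in> underS r i. k \<in> underS r l"
        using under_cases under_Field by blast
      then show ?thesis
      proof cases
        case 1
        obtain z where "z \<in> P" using cofinal by blast
        then have "wide_region i = UNIV" using extent_root[OF 1] in_wide_region by auto
        then show ?thesis unfolding B_def by simp
      next
        case (2 k)
        then have "countable (wide_region k - wide_region i - (\<Union>S \<in> wide_cones i. ends S))"
          using ct under_Field by (intro successor_remainder_countable[OF i 2]) blast
        then show ?thesis
          by (rule countable_subset[rotated]) (use 2 in \<open>auto simp: B_def E_def\<close>)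
      next
        case 3
        have "y \<notin> B" for y
          using limit_remainder[OF i 3, of y] Y(2) unfolding B_def E_def by blast
        then have "B = {}" by blast
        then show ?thesis by simp
      qed
    qed
    ultimately show False by blast
  qed
qed

lemma level_uncountable:
  assumes Y: "bi_bernstein Y" "Y \<inter> X0 = {}"
  shows "\<exists>i x n. i \<in> Field r \<and> x \<in> P \<and> uncountable (range (level i (K i x) n))"
proof (rule ccontr)
  assume "\<not> ?thesis"
  then have "countable (range (level i (K i x) n))" if "i \<in> Field r" "x \<in> P" for i x n
    using that by blast
  then have "countable (- wide_region i)" if "i \<in> Field r" for i
    using cocountable_wide_region[OF _ Y that] by blast
  then have "countable (\<Union>i \<in> Field r. - wide_region i)" using index_countable by blast
  then have "uncountable (X0 - (\<Union>i \<in> Field r. - wide_region i))"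
    using unc0 by (simp add: uncountable_minus_countable)
  then have "X0 - (\<Union>i \<in> Field r. - wide_region i) \<noteq> {}" by (metis countable_empty)
  then obtain t where t: "t \<in> X0" "\<And>i. i \<in> Field r \<Longrightarrow> t \<in> wide_region i" by blast
  then obtain z w where zw: "(z, w) \<in> lex_power X r" "z \<noteq> w" "h z = t" "h w = t"
    using two by blast
  from zw(1) show False
  proof (cases rule: lex_cases)
    case (2 j)
    \<comment> \<open>A cone whose level is past the first difference \<open>j\<close> of
      \<open>z\<close> and \<open>w\<close> fixes coordinate \<open>j\<close>, yet would contain
      both points.\<close>
    obtain i where i: "i \<in> Field r" "j \<in> underS r i" using no_last[OF 2(1)] above_Field by blast
    then obtain x a b where x: "a \<in> K i x" "b \<in> K i x" "h a < t" "t < h b"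
      using t(2) unfolding in_wide_region extent_def by blast
    have "z \<in> K i x" "w \<in> K i x"
      using cone_between[of a i x b] x zw lex_points i by auto
    then show False using 2(3) i(2) unfolding cone_def by simp
  qed (use zw in simp)
qed

lemma order_map:
  assumes Y: "bi_bernstein Y" "Y \<inter> X0 = {}"
  obtains f :: "real \<Rightarrow> real" where "mono f" "uncountable (range f)" "countable (f ` Y \<inter> X)"
  using level_uncountable[OF Y] mono_level countable_level_image[OF _ _ Y(2)] by metis

end


section \<open>Dense embeddings\<close>

text \<open>Density is expressed by intervals instead of the topology, which makes it easy to carry
  along isomorphisms and order reversal.\<close>

definition dense_embedding :: "'a rel \<Rightarrow> 'c rel \<Rightarrow> ('a \<Rightarrow> 'c) \<Rightarrow> bool" where
  "dense_embedding Z C e \<longleftrightarrow>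
     e ` Field Z \<subseteq> Field C \<and>
     (\<forall>x \<in> Field Z. \<forall>y \<in> Field Z. (x, y) \<in> Z \<longleftrightarrow> (e x, e y) \<in> C) \<and>
     (\<forall>c d. (c, d) \<in> C - Id \<longrightarrow> (\<exists>z \<in> Field Z. (c, e z) \<in> C - Id \<and> (e z, d) \<in> C - Id))"

text \<open>Order density of \<open>C\<close> makes each open interval a nonempty open set, so the
  topologically dense image meets it.\<close>

lemma completion_dense_embedding:
  assumes "is_completion Z C"
  shows "\<exists>e. dense_embedding Z C e"
proof -
  obtain e where e: "e ` Field Z \<subseteq> Field C" "iso Z (Restr C (e ` Field Z)) e"
    "lots_topology C closure_of (e ` Field Z) = Field C"
    using assms unfolding is_completion_def by blast
  have dns: "order_dense C" using assms unfolding is_completion_def by blast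
  have "\<exists>z \<in> Field Z. (c, e z) \<in> C - Id \<and> (e z, d) \<in> C - Id" if cd: "(c, d) \<in> C - Id" for c d
  proof -
    obtain m where m: "(c, m) \<in> C - Id" "(m, d) \<in> C - Id"
      using dns cd unfolding order_dense_def by blast
    let ?U = "aboveS C c \<inter> underS C d"
    have F: "c \<in> Field C" "d \<in> Field C" "m \<in> Field C" using cd m by (auto simp: Field_def)
    have "openin (lots_topology C) (aboveS C c)" "openin (lots_topology C) (underS C d)"
      unfolding lots_topology_def using F by (auto intro!: topology_generated_by_Basis)
    then have "openin (lots_topology C) ?U" by blast
    moreover have "m \<in> ?U" using m by (auto simp: aboveS_def underS_def)
    moreover have "m \<in> lots_topology C closure_of (e ` Field Z)" using e(3) F by simp
    ultimately obtain y where "y \<in> e ` Field Z" "y \<in> ?U" unfolding in_closure_of by blast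
    then show ?thesis by (auto simp: aboveS_def underS_def)
  qed
  moreover have "(x, y) \<in> Z \<longleftrightarrow> (e x, e y) \<in> C" if "x \<in> Field Z" "y \<in> Field Z" for x y
    using e(2) that unfolding iso_iff2 by auto
  ultimately show ?thesis using e(1) unfolding dense_embedding_def by blast
qed

lemma dense_embedding_iso:
  assumes e: "dense_embedding Z C e" and g: "iso C D g"
  shows "dense_embedding Z D (g \<circ> e)"
proof -
  have bij: "bij_betw g (Field C) (Field D)"
    and iff: "\<And>a b. a \<in> Field C \<Longrightarrow> b \<in> Field C \<Longrightarrow> (a, b) \<in> C \<longleftrightarrow> (g a, g b) \<in> D"
    using g unfolding iso_iff2 by auto
  have eF: "\<And>z. z \<in> Field Z \<Longrightarrow> e z \<in> Field C"
    and e_iff: "\<And>x y. x \<in> Field Z \<Longrightarrow> y \<in> Field Z \<Longrightarrow> (x, y) \<in> Z \<longleftrightarrow> (e x, e y) \<in> C"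
    using e unfolding dense_embedding_def by auto
  have strict: "(a, b) \<in> C - Id \<longleftrightarrow> (g a, g b) \<in> D - Id" if "a \<in> Field C" "b \<in> Field C" for a b
    using iff[OF that] bij that unfolding bij_betw_def inj_on_def by auto
  have "\<exists>z \<in> Field Z. (c, g (e z)) \<in> D - Id \<and> (g (e z), d) \<in> D - Id" if cd: "(c, d) \<in> D - Id" for c d
  proof -
    have "c \<in> g ` Field C" "d \<in> g ` Field C"
      using cd bij unfolding bij_betw_def by (auto simp: Field_def)
    then obtain a b where ab: "a \<in> Field C" "b \<in> Field C" "c = g a" "d = g b" by blast
    then have "(a, b) \<in> C - Id" using cd strict by blast
    then obtain z where z: "z \<in> Field Z" "(a, e z) \<in> C - Id" "(e z, b) \<in> C - Id"
      using e unfolding dense_embedding_def by blast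
    show ?thesis
      using z strict[OF ab(1) eF[OF z(1)]] strict[OF eF[OF z(1)] ab(2)] ab by blast
  qed
  moreover have "(x, y) \<in> Z \<longleftrightarrow> (g (e x), g (e y)) \<in> D" if "x \<in> Field Z" "y \<in> Field Z" for x y
    using that e_iff iff eF by blast
  ultimately show ?thesis
    using eF bij unfolding dense_embedding_def bij_betw_def by auto
qed

section \<open>Lexicographic powers inside a common order\<close>

lemma least_index:
  assumes "countable_limit_ordinal r"
  obtains i where "i \<in> Field r" "underS r i = {}"
proof -
  have wf: "wf (r - Id)" and ne: "Field r \<noteq> {}"
    using assms unfolding countable_limit_ordinal_def well_order_on_def by auto
  obtain a where "a \<in> Field r" using ne by blast
  then obtain i where i: "i \<in> Field r" "\<And>j. (j, i) \<in> r - Id \<Longrightarrow> j \<notin> Field r"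
    by (rule wfE_min[OF wf]) (rule that)
  have "underS r i = {}" using i(2) unfolding underS_def Field_def by blast
  then show ?thesis using that i by blast
qed

lemma power_points_nonempty:
  assumes "\<rat> \<subseteq> X"
  shows "(\<lambda>i. if i \<in> Field r then 0 else undefined) \<in> power_points X r"
  using assms Rats_0 unfolding power_points_def PiE_def Pi_def extensional_def by auto

lemma lex_power_upd_less:
  "x(i := a) \<in> power_points X r \<Longrightarrow> x(i := b) \<in> power_points X r \<Longrightarrow> i \<in> Field r \<Longrightarrow> a < b \<Longrightarrow>
    (x(i := a), x(i := b)) \<in> lex_power X r - Id"
  unfolding lex_power_def by (auto simp: underS_def dest: fun_cong[of _ _ i])

lemma lex_power_antisym:
  assumes "countable_limit_ordinal r" "(x, y) \<in> lex_power X r" "(y, x) \<in> lex_power X r"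
  shows "x = y"
proof -
  have "Linear_order (lex_power X r)"
    using assms(1) unfolding countable_limit_ordinal_def by (intro linear_order_lex_power) blast
  then show ?thesis using assms(2,3) by (rule linear_order_facts(3))
qed

text \<open>The coordinate at the least index is not confined to [-1, 1], so it can be moved to a
  rational in either direction.\<close>

lemma lex_power_unbounded:
  assumes r: "countable_limit_ordinal r" and X: "\<rat> \<subseteq> X" and z: "z \<in> power_points X r"
  shows "\<exists>w. (z, w) \<in> lex_power X r - Id" "\<exists>w. (w, z) \<in> lex_power X r - Id"
proof -
  obtain i where i: "i \<in> Field r" "underS r i = {}" using least_index[OF r] by blast
  obtain p q :: real where "p \<in> \<rat>" "p < z i" "q \<in> \<rat>" "z i < q"
    using Rats_dense_in_real[of "z i - 1" "z i"] Rats_dense_in_real[of "z i" "z i + 1"] by auto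
  then show "\<exists>w. (z, w) \<in> lex_power X r - Id" "\<exists>w. (w, z) \<in> lex_power X r - Id"
    using lex_power_upd_less[of z i "z i" X r q] lex_power_upd_less[of z i p X r "z i"]
      power_points_upd[OF z i(1), of p] power_points_upd[OF z i(1), of q] z i X by auto
qed

lemma not_has_max_min_lex_power:
  assumes "countable_limit_ordinal r" "\<rat> \<subseteq> X"
  shows "\<not> has_max (lex_power X r)" "\<not> has_min (lex_power X r)"
proof -
  note an = lex_power_antisym[OF assms(1)]
  show "\<not> has_max (lex_power X r)"
  proof
    assume "has_max (lex_power X r)"
    then obtain z where z: "z \<in> power_points X r" "\<And>w. w \<in> power_points X r \<Longrightarrow> (w, z) \<in> lex_power X r"
      unfolding has_max_def Above_def Field_lex_power by blast
    obtain w where w: "(z, w) \<in> lex_power X r - Id" using lex_power_unbounded(1)[OF assms z(1)] by blast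
    then have "w \<in> power_points X r" unfolding lex_power_def by blast
    then show False using w z(2) an by blast
  qed
  show "\<not> has_min (lex_power X r)"
  proof
    assume "has_min (lex_power X r)"
    then obtain z where z: "z \<in> power_points X r" "\<And>w. w \<in> power_points X r \<Longrightarrow> (z, w) \<in> lex_power X r"
      unfolding has_min_def Under_def Field_lex_power by blast
    obtain w where w: "(w, z) \<in> lex_power X r - Id" using lex_power_unbounded(2)[OF assms z(1)] by blast
    then have "w \<in> power_points X r" unfolding lex_power_def by blast
    then show False using w z(2) an by blast
  qed
qed

lemma unbounded_steps:
  assumes C: "Linear_order C" and c: "c \<in> Field C"
  shows "\<not> has_max C \<Longrightarrow> \<exists>d. (c, d) \<in> C - Id" "\<not> has_min C \<Longrightarrow> \<exists>d. (d, c) \<in> C - Id"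
  using linear_order_facts(1,4)[OF C] c
  unfolding has_max_def has_min_def Above_def Under_def by blast+

text \<open>\<open>h w\<close> is the supremum of the first coordinates of those points of the power
  of \<open>X0\<close> that lie below \<open>w\<close> in \<open>C\<close>.\<close>

lemma power_projection_exists:
  fixes C :: "'c rel"
  assumes C: "Linear_order C" "\<not> has_max C" "\<not> has_min C"
    and s: "countable_limit_ordinal s" and r: "countable_limit_ordinal r"
    and X0: "\<rat> \<subseteq> X0" "uncountable X0" and X: "\<rat> \<subseteq> X"
    and e: "dense_embedding (lex_power X0 s) C e" and p: "dense_embedding (lex_power X r) C p"
  shows "\<exists>h. power_projection X X0 r h"
proof -
  note ord = linear_order_facts[OF C(1)]
  note FL = Field_lex_power
  obtain m where m: "m \<in> Field s" "underS s m = {}" using least_index[OF s] by blast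
  have eF: "\<And>z. z \<in> power_points X0 s \<Longrightarrow> e z \<in> Field C"
    and e_iff: "\<And>z w. z \<in> power_points X0 s \<Longrightarrow> w \<in> power_points X0 s \<Longrightarrow>
        (z, w) \<in> lex_power X0 s \<longleftrightarrow> (e z, e w) \<in> C"
    and e_dense: "\<And>c d. (c, d) \<in> C - Id \<Longrightarrow>
        \<exists>z \<in> power_points X0 s. (c, e z) \<in> C - Id \<and> (e z, d) \<in> C - Id"
    using e unfolding dense_embedding_def FL by auto
  have pF: "\<And>z. z \<in> power_points X r \<Longrightarrow> p z \<in> Field C"
    and p_iff: "\<And>z w. z \<in> power_points X r \<Longrightarrow> w \<in> power_points X r \<Longrightarrow>
        (z, w) \<in> lex_power X r \<longleftrightarrow> (p z, p w) \<in> C"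
    and p_dense: "\<And>c d. (c, d) \<in> C - Id \<Longrightarrow>
        \<exists>z \<in> power_points X r. (c, p z) \<in> C - Id \<and> (p z, d) \<in> C - Id"
    using p unfolding dense_embedding_def FL by auto
  have first: "z m \<le> w m" if "(z, w) \<in> lex_power X0 s" for z w
  proof -
    have "i = m \<or> m \<in> underS s i" if "i \<in> Field s" for i
      using linear_order_facts(4)[of s i m] s m that
      unfolding countable_limit_ordinal_def well_order_on_def underS_def by blast
    then show ?thesis using that unfolding lex_power_def by force
  qed
  define A where "A w = {z m | z. z \<in> power_points X0 s \<and> (e z, p w) \<in> C}" for w
  define h where "h w = Sup (A w)" for w
  have upper: "a \<le> z m" if "a \<in> A w" "z \<in> power_points X0 s" "(p w, e z) \<in> C" for a z w
    using that first e_iff ord(2) unfolding A_def by blast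
  have ne: "A w \<noteq> {}" if w: "w \<in> power_points X r" for w
  proof -
    obtain d where "(d, p w) \<in> C - Id" using unbounded_steps(2)[OF C(1) pF[OF w] C(3)] by blast
    then show ?thesis using e_dense unfolding A_def by blast
  qed
  have bdd: "bdd_above (A w)" if w: "w \<in> power_points X r" for w
  proof -
    obtain d where "(p w, d) \<in> C - Id" using unbounded_steps(1)[OF C(1) pF[OF w] C(2)] by blast
    then obtain z where "z \<in> power_points X0 s" "(p w, e z) \<in> C" using e_dense by blast
    then show ?thesis using upper by (intro bdd_aboveI[of _ "z m"]) blast
  qed
  have h_ge: "z m \<le> h w" if "z \<in> power_points X0 s" "w \<in> power_points X r" "(e z, p w) \<in> C" for z w
    unfolding h_def using that by (intro cSup_upper bdd) (auto simp: A_def)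
  have h_le: "h w \<le> z m" if "z \<in> power_points X0 s" "w \<in> power_points X r" "(p w, e z) \<in> C" for z w
    unfolding h_def using that upper by (intro cSup_least ne) auto
  have lexP: "z \<in> power_points X r" "w \<in> power_points X r" if "(z, w) \<in> lex_power X r" for z w
    using that unfolding lex_power_def by auto
  have "power_projection X X0 r h"
  proof
    show "countable_limit_ordinal r" "\<rat> \<subseteq> X" "\<rat> \<subseteq> X0" "uncountable X0" by fact+
    show "h z \<le> h w" if zw: "(z, w) \<in> lex_power X r" for z w
    proof -
      have "A z \<subseteq> A w" using ord(2) p_iff lexP[OF zw] zw unfolding A_def by blast
      then show ?thesis unfolding h_def using lexP[OF zw] by (intro cSup_subset_mono ne bdd)
    qed
    show "\<exists>z w. (z, w) \<in> lex_power X r - Id \<and> h z = t \<and> h w = t" if t: "t \<in> X0" for t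
    proof -
      obtain k where k: "k \<in> Field s" "k \<noteq> m"
        using s m unfolding countable_limit_ordinal_def aboveS_def Field_def by blast
      obtain x where x: "x \<in> power_points X0 s" using power_points_nonempty[OF X0(1)] by blast
      define y where "y = x(m := t)"
      have y: "y \<in> power_points X0 s" unfolding y_def using power_points_upd[OF x m(1) t] m by simp
      \<comment> \<open>Two points with first coordinate \<open>t\<close> that differ only at
        \<open>k\<close>. Density puts two points of the other power between their images in
        \<open>C\<close>, and \<open>h\<close> is squeezed to \<open>t\<close> at both.\<close>
      define a b where "a = y(k := 0)" and "b = y(k := 1)"
      have ab: "a \<in> power_points X0 s" "b \<in> power_points X0 s" "a m = t" "b m = t"
        unfolding a_def b_def using power_points_upd[OF y k(1)] k X0(1) by (auto simp: y_def)
      have "(a, b) \<in> lex_power X0 s - Id"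
        using ab k unfolding a_def b_def by (intro lex_power_upd_less) auto
      moreover have "e a \<noteq> e b"
      proof
        assume "e a = e b"
        then have "(b, a) \<in> lex_power X0 s"
          using e_iff[OF ab(2,1)] ord(1)[OF eF[OF ab(1)]] by simp
        then show False
          using lex_power_antisym[OF s] \<open>(a, b) \<in> lex_power X0 s - Id\<close> by blast
      qed
      ultimately have "(e a, e b) \<in> C - Id" using e_iff ab by auto
      then obtain z where z: "z \<in> power_points X r" "(e a, p z) \<in> C - Id" "(p z, e b) \<in> C - Id"
        using p_dense by blast
      then obtain w where w: "w \<in> power_points X r" "(p z, p w) \<in> C - Id" "(p w, e b) \<in> C - Id"
        using p_dense by blast
      have "(e a, p w) \<in> C" using z w ord(2) by blast
      then have "h w = t" using h_ge[OF ab(1) w(1)] h_le[OF ab(2) w(1)] w(3) ab(3,4) by simp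
      moreover have "(p z, e b) \<in> C" "(e a, p z) \<in> C" using z by auto
      then have "h z = t" using h_ge[OF ab(1) z(1)] h_le[OF ab(2) z(1)] ab(3,4) by simp
      moreover have "(z, w) \<in> lex_power X r - Id" using p_iff[OF z(1) w(1)] w(2) by auto
      ultimately show ?thesis by blast
    qed
    show "h z \<in> X0" if zw: "(z, w) \<in> lex_power X r - Id" and eq: "h z = h w" for z w
    proof -
      have P: "z \<in> power_points X r" "w \<in> power_points X r" using zw lexP by auto
      have "p z \<noteq> p w"
      proof
        assume "p z = p w"
        then have "(w, z) \<in> lex_power X r"
          using p_iff[OF P(2,1)] ord(1)[OF pF[OF P(1)]] by simp
        then show False using lex_power_antisym[OF r] zw by blast
      qed
      then have "(p z, p w) \<in> C - Id" using p_iff P zw by auto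
      \<comment> \<open>The first coordinate of \<open>u\<close> lies between \<open>h z\<close> and
        \<open>h w\<close>, hence equals both.\<close>
      then obtain u where u: "u \<in> power_points X0 s" "(p z, e u) \<in> C" "(e u, p w) \<in> C"
        using e_dense by blast
      then have "h z = u m" using h_ge[OF u(1) P(2)] h_le[OF u(1) P(1)] eq by simp
      then show ?thesis using u(1) m(1) unfolding power_points_def by auto
    qed
  qed
  then show ?thesis by blast
qed

section \<open>Hart-van Mill collections\<close>

lemma hart_van_millD:
  assumes "hart_van_mill H V"
  shows "\<rat> \<subseteq> V" "bi_bernstein V" "pairwise disjnt (insert V H)"
    and "Y \<in> H \<Longrightarrow> bi_bernstein Y" "Y \<in> H \<Longrightarrow> uminus ` Y \<in> H" "Y \<in> H \<Longrightarrow> uminus ` Y \<noteq> Y"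
    and "mono f \<Longrightarrow> Y \<in> H \<Longrightarrow> has_card_continuum (f ` Y - Y) \<Longrightarrow> has_card_continuum (f ` Y \<inter> V)"
  using assms unfolding hart_van_mill_def by simp_all

text \<open>\<open>V\<close> is not in \<open>H\<close>: otherwise its reflection would be a
  different, hence disjoint, member, although both contain 0. So \<open>V\<close> is disjoint from
  every member of \<open>J\<close>.\<close>

lemma base_set_subset_hvm_space:
  assumes "hart_van_mill H V" "J \<subseteq> H"
  shows "V \<subseteq> hvm_space J"
proof -
  note V = hart_van_millD(1)[OF assms(1)] and disj = hart_van_millD(3)[OF assms(1)]
    and sym = hart_van_millD(5,6)[OF assms(1)]
  have "V \<notin> H"
  proof
    assume "V \<in> H"
    then have "disjnt (uminus ` V) V"
      using sym[of V] by (intro pairwiseD[OF disj]) auto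
    moreover have "0 \<in> V" using V Rats_0 by blast
    then have "0 \<in> uminus ` V" by force
    ultimately show False using \<open>0 \<in> V\<close> unfolding disjnt_def by blast
  qed
  then have "disjnt V Y" if "Y \<in> J" for Y
    using that assms(2) by (intro pairwiseD[OF disj]) auto
  then show ?thesis unfolding hvm_space_def disjnt_def by blast
qed

lemma hvm_subset:
  fixes C :: "'c rel"
  assumes hvm: "hart_van_mill H V" and J: "J \<subseteq> H" and J1: "J1 \<subseteq> H"
    and C: "Linear_order C" "\<not> has_max C" "\<not> has_min C"
    and s: "countable_limit_ordinal s" and r: "countable_limit_ordinal r"
    and e: "dense_embedding (lex_power (hvm_space J) s) C e"
    and p: "dense_embedding (lex_power (hvm_space J1) r) C p"
  shows "J \<subseteq> J1"
proof
  fix Y assume Y: "Y \<in> J"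
  have V: "\<rat> \<subseteq> V" "bi_bernstein V" and disj: "pairwise disjnt (insert V H)"
    and YB: "bi_bernstein Y"
    and om: "\<And>f. mono f \<Longrightarrow> has_card_continuum (f ` Y - Y) \<Longrightarrow> has_card_continuum (f ` Y \<inter> V)"
    using hart_van_millD[OF hvm] Y J by auto
  have VX: "V \<subseteq> hvm_space J" "V \<subseteq> hvm_space J1"
    using base_set_subset_hvm_space[OF hvm] J J1 by auto
  have "uncountable V"
    using bi_bernstein_Int_closed_card[OF V(2) closed_UNIV uncountable_UNIV_real]
      has_card_continuum_uncountable by auto
  then have unc: "uncountable (hvm_space J)" using VX countable_subset by blast
  obtain h where "power_projection (hvm_space J1) (hvm_space J) r h"
    using power_projection_exists[OF C s r _ unc _ e p] V VX by blast
  moreover have "Y \<inter> hvm_space J = {}" using Y unfolding hvm_space_def by blast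
  ultimately obtain f :: "real \<Rightarrow> real"
    where f: "mono f" "uncountable (range f)" "countable (f ` Y \<inter> hvm_space J1)"
    using power_projection.order_map YB by metis
  show "Y \<in> J1"
  proof (rule ccontr)
    assume "Y \<notin> J1"
    then have "disjnt Y Y'" if "Y' \<in> J1" for Y'
      using that Y J J1 by (intro pairwiseD[OF disj]) auto
    then have YX: "Y \<subseteq> hvm_space J1" unfolding hvm_space_def disjnt_def by blast
    \<comment> \<open>\<open>f\<close> takes continuum many values on \<open>Y\<close>, only
      countably many of them in the second space. That space contains both \<open>Y\<close> and
      \<open>V\<close>, so condition (v) is violated.\<close>
    have "has_card_continuum (f ` Y)"
      using bi_bernstein_image_card[OF YB f(1) closed_UNIV f(2)] by simp
    then have "has_card_continuum (f ` Y - f ` Y \<inter> hvm_space J1)"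
      using has_card_continuum_diff_countable f(3) by blast
    moreover have "f ` Y - f ` Y \<inter> hvm_space J1 \<subseteq> f ` Y - Y" using YX by blast
    ultimately have "has_card_continuum (f ` Y - Y)"
      unfolding has_card_continuum_iff_lepoll by (meson lepoll_trans subset_imp_lepoll)
    then have "uncountable (f ` Y \<inter> V)" using om f(1) has_card_continuum_uncountable by blast
    then show False using f(3) VX countable_subset[of "f ` Y \<inter> V" "f ` Y \<inter> hvm_space J1"] by blast
  qed
qed

text \<open>Changing the sign of all coordinates reverses the lexicographic order, respects the
  bounds -1 and 1, and exchanges the spaces of \<open>J\<close> and of its reflection.\<close>

lemma dense_embedding_converse_neg:
  fixes r :: "'i rel"
  assumes e: "dense_embedding (lex_power (hvm_space J) r) C e"
  shows "\<exists>p. dense_embedding (lex_power (hvm_space ((`) uminus ` J)) r) (C\<inverse>) p"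
proof -
  let ?X = "hvm_space J" and ?X1 = "hvm_space ((`) uminus ` J)"
  define g where "g w = (\<lambda>i. if i \<in> Field r then - w i else undefined)" for w :: "'i \<Rightarrow> real"
  have X1: "c \<in> ?X1 \<longleftrightarrow> - c \<in> ?X" for c
    unfolding hvm_space_def by (auto simp: image_iff) (metis minus_minus)+
  have maps1: "g w \<in> power_points ?X r" if "w \<in> power_points ?X1 r" for w
    using that X1 unfolding power_points_def PiE_def Pi_def extensional_def g_def by force
  have maps2: "g w \<in> power_points ?X1 r" if "w \<in> power_points ?X r" for w
    using that X1 unfolding power_points_def PiE_def Pi_def extensional_def g_def by force
  have gg: "g (g w) = w" if "w \<in> power_points Z r" for w Z
    using that unfolding power_points_def PiE_def extensional_def g_def by auto
  have lex: "(x, y) \<in> lex_power ?X1 r \<longleftrightarrow> (g y, g x) \<in> lex_power ?X r"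
    if P: "x \<in> power_points ?X1 r" "y \<in> power_points ?X1 r" for x y
  proof -
    have "g x = g y \<longleftrightarrow> x = y" using gg P by metis
    moreover have "(\<forall>j \<in> underS r i. g y j = g x j) \<and> g y i < g x i \<longleftrightarrow>
        (\<forall>j \<in> underS r i. x j = y j) \<and> x i < y i" if "i \<in> Field r" for i
      using that unfolding g_def underS_def Field_def by auto
    ultimately show ?thesis using maps1 P unfolding lex_power_def by auto
  qed
  have "dense_embedding (lex_power ?X1 r) (C\<inverse>) (e \<circ> g)"
    unfolding dense_embedding_def Field_lex_power
  proof (intro conjI ballI allI impI)
    show "(e \<circ> g) ` power_points ?X1 r \<subseteq> Field (C\<inverse>)"
      using e maps1 unfolding dense_embedding_def Field_lex_power by auto
    show "(x, y) \<in> lex_power ?X1 r \<longleftrightarrow> ((e \<circ> g) x, (e \<circ> g) y) \<in> C\<inverse>"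
      if "x \<in> power_points ?X1 r" "y \<in> power_points ?X1 r" for x y
      using e maps1 lex[OF that] that unfolding dense_embedding_def Field_lex_power by simp
    fix c d assume "(c, d) \<in> C\<inverse> - Id"
    then have "(d, c) \<in> C - Id" by auto
    then obtain z where z: "z \<in> power_points ?X r" "(d, e z) \<in> C - Id" "(e z, c) \<in> C - Id"
      using e unfolding dense_embedding_def Field_lex_power by blast
    then show "\<exists>z \<in> power_points ?X1 r. (c, (e \<circ> g) z) \<in> C\<inverse> - Id \<and> ((e \<circ> g) z, d) \<in> C\<inverse> - Id"
      using maps2[OF z(1)] gg[OF z(1)] by (intro bexI[of _ "g z"]) auto
  qed
  then show ?thesis by blast
qed

theorem theorem9p21:
  fixes H :: "real set set" and V :: "real set" and J :: "real set set"
    and \<alpha> :: "'i rel" and C :: "'c rel"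
  assumes "hart_van_mill H V"
    and "J \<subseteq> H" "J \<noteq> {}"
    and "countable_limit_ordinal \<alpha>"
    and "is_completion (lex_power (hvm_space J) \<alpha>) C"
  shows "(\<forall>(J1 :: real set set) (\<beta> :: 'j rel) (C1 :: 'd rel).
            J1 \<subseteq> H \<and> J1 \<noteq> {} \<and> J1 \<noteq> J \<and> countable_limit_ordinal \<beta> \<and>
            is_completion (lex_power (hvm_space J1) \<beta>) C1 \<longrightarrow>
            \<not> order_isomorphic C C1)
       \<and> ((\<exists>Y \<in> J. uminus ` Y \<notin> J) \<longrightarrow> \<not> symmetric_order C)"
proof (intro conjI allI impI notI)
  have rat: "\<rat> \<subseteq> hvm_space J'" if "J' \<subseteq> H" for J'
    using base_set_subset_hvm_space[OF assms(1) that] hart_van_millD(1)[OF assms(1)] by blast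
  obtain e where e: "dense_embedding (lex_power (hvm_space J) \<alpha>) C e"
    using completion_dense_embedding[OF assms(5)] by blast
  {
    fix J1 :: "real set set" and \<beta> :: "'j rel" and C1 :: "'d rel"
    assume *: "J1 \<subseteq> H \<and> J1 \<noteq> {} \<and> J1 \<noteq> J \<and> countable_limit_ordinal \<beta> \<and>
            is_completion (lex_power (hvm_space J1) \<beta>) C1"
    then have J1: "J1 \<subseteq> H" "J1 \<noteq> J" "countable_limit_ordinal \<beta>"
      and C1: "is_completion (lex_power (hvm_space J1) \<beta>) C1" by auto
    assume "order_isomorphic C C1"
    then obtain g where g: "iso C C1 g" unfolding order_isomorphic_def by blast
    obtain p where p: "dense_embedding (lex_power (hvm_space J1) \<beta>) C1 p"
      using completion_dense_embedding[OF C1] by blast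
    note ge = dense_embedding_iso[OF e g]
    have "Linear_order C1" "\<not> has_max C1" "\<not> has_min C1"
      using C1 not_has_max_min_lex_power[OF J1(3) rat[OF J1(1)]] unfolding is_completion_def by auto
    \<comment> \<open>With both powers dense in \<open>C1\<close>, the roles of \<open>J\<close> and
      \<open>J1\<close> can be exchanged, which gives both inclusions.\<close>
    note hs = hvm_subset[OF assms(1) _ _ this]
    have "J \<subseteq> J1" using hs[OF assms(2) J1(1) assms(4) J1(3) ge p] .
    moreover have "J1 \<subseteq> J" using hs[OF J1(1) assms(2) J1(3) assms(4) p ge] .
    ultimately show False using J1(2) by blast
  }
  assume "\<exists>Y \<in> J. uminus ` Y \<notin> J"
  then obtain Y where Y: "Y \<in> J" "uminus ` Y \<notin> J" by blast
  assume "symmetric_order C"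
  then obtain g where g: "iso C (C\<inverse>) g" unfolding symmetric_order_def by blast
  \<comment> \<open>A symmetry of \<open>C\<close> makes the powers over \<open>J\<close> and over
    its reflection \<open>?J1\<close> dense in the converse of \<open>C\<close>. The resulting
    inclusion \<open>J \<subseteq> ?J1\<close> puts the reflection of \<open>Y\<close> into
    \<open>J\<close>.\<close>
  let ?J1 = "(`) uminus ` J"
  obtain p where p: "dense_embedding (lex_power (hvm_space ?J1) \<alpha>) (C\<inverse>) p"
    using dense_embedding_converse_neg[OF e] by blast
  have "?J1 \<subseteq> H" using hart_van_millD(5)[OF assms(1)] assms(2) by blast
  moreover have "Linear_order (C\<inverse>)" "\<not> has_max (C\<inverse>)" "\<not> has_min (C\<inverse>)"
    using assms(5) not_has_max_min_lex_power[OF assms(4) rat[OF assms(2)]]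
    unfolding is_completion_def has_max_def has_min_def by (simp_all add: Above_def Under_def)
  ultimately have "J \<subseteq> ?J1"
    using hvm_subset[OF assms(1,2) _ _ _ _ assms(4,4) dense_embedding_iso[OF e g] p] by blast
  then obtain Y' where "Y' \<in> J" "Y = uminus ` Y'" using Y(1) by blast
  then show False using Y(2) by (simp add: image_image)
qed

end
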